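(* Let $p$ be a prime with $p>48$, and let $N$ be a multiple of $p^2$. (i) If $A,B,C\in\mathbb{Z}_p$ are not all zero and $F:\mathbb{B}\to(\mathbb{Z}/p\mathbb{Z})^\times$ satisfies $F(n,m)=f_p(An+Bm+C)$ for all $(n,m)\in\mathbb{B}$, then $F$ is an $\mathcal{S}_{p,N}$-Sudoku solution; furthermore, if $\nu_p(B)=0$, then $F$ has non-constant columns. (ii) Conversely, if $F$ is an $\mathcal{S}_{p,N}$-Sudoku solution with non-constant columns, then there exist $A,B,C\in\mathbb{Z}_p$ with $\nu_p(B)=0$ such that $F(n,m)=f_p(An+Bm+C)$ for all $(n,m)\in\mathbb{B}$ with $An+Bm+C\neq0$.
   Context: $\mathbb{Z}_p$ denotes the ring of $p$-adic integers, $\pi_p:\mathbb{Z}_p\to\mathbb{Z}/p\mathbb{Z}$ the reduction map, $(\mathbb{Z}/p\mathbb{Z})^\times=(\mathbb{Z}/p\mathbb{Z})\setminus\{0\}$. For $n\in\mathbb{Z}_p$, $\nu_p(n)\in\{0,1,2,\dots\}\cup\{+\infty\}$ is the $p$-adic valuation ($\nu_p(0)=+\infty$). Define $f_p:\mathbb{Z}_p\to(\mathbb{Z}/p\mathbb{Z})^\times$ by $f_p(n)=\pi_p(n/p^{\nu_p(n)})$ for $n\neq0$ and $f_p(0)=1\bmod p$. The Sudoku board is $\mathbb{B}=\{0,\dots,N-1\}\times\mathbb{Z}$. The Sudoku rule $\mathcal{S}_{p,N}$ is the set of functions $g:\{0,\dots,N-1\}\to(\mathbb{Z}/p\mathbb{Z})^\times$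 for which there exist integers $a,b$, not both divisible by $p$, such that $g(n)=f_p(an+b)$ for all $n\in\{0,\dots,N-1\}$ with $\nu_p(an+b)\le1$. An $\mathcal{S}_{p,N}$-Sudoku solution is a function $F:\mathbb{B}\to(\mathbb{Z}/p\mathbb{Z})^\times$ such that for all $j,i\in\mathbb{Z}$ the function $n\mapsto F(n,jn+i)$ lies in $\mathcal{S}_{p,N}$. $F$ has non-constant columns if for every $n\in\{0,\dots,N-1\}$ the function $m\mapsto F(n,m)$ is non-constant on $\mathbb{Z}$. *)

theory Defs
  imports
    "HOL-Algebra.Divisibility"
    "HOL-Number_Theory.Residues"
    "HOL-Library.Extended_Nat"
    "HOL-Library.FuncSet"
begin

section \<open>The ring of p-adic integers\<close>

text \<open>
  The inverse limit of the rings of integers modulo \<open>p ^ k\<close>: an element \<open>x\<close> is a compatible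
  sequence of residues, \<open>x k\<close> being the canonical representative of \<open>x\<close> modulo \<open>p ^ k\<close>.
\<close>

definition padic_ints :: "nat \<Rightarrow> (nat \<Rightarrow> int) ring" where
  "padic_ints p =
    \<lparr>carrier = {x. \<forall>k. x k \<in> {0..<int p ^ k} \<and> x (Suc k) mod int p ^ k = x k},
     monoid.mult = (\<lambda>x y k. (x k * y k) mod int p ^ k),
     monoid.one = (\<lambda>k. 1 mod int p ^ k),
     ring.zero = (\<lambda>k. 0),
     ring.add = (\<lambda>x y k. (x k + y k) mod int p ^ k)\<rparr>"

text \<open>The embedding of the integers.\<close>

definition padic_of_int :: "nat \<Rightarrow> int \<Rightarrow> nat \<Rightarrow> int" where
  "padic_of_int p n = (\<lambda>k. n mod int p ^ k)"

definition padic_val :: "nat \<Rightarrow> (nat \<Rightarrow> int) \<Rightarrow> enat" where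
  "padic_val p x =
    (if x = \<zero>\<^bsub>padic_ints p\<^esub> then \<infinity>
     else enat (GREATEST k. padic_of_int p (int p ^ k) divides\<^bsub>padic_ints p\<^esub> x))"

text \<open>
  The integers modulo \<open>p\<close> are \<^term>\<open>residue_ring (int p)\<close>, with carrier \<open>{0..p - 1}\<close>. The
  first coordinate of a p-adic integer is its representative there.
\<close>

definition padic_reduce :: "(nat \<Rightarrow> int) \<Rightarrow> int" where
  "padic_reduce x = x 1"

definition nonzero_residues :: "nat \<Rightarrow> int set" where
  "nonzero_residues p = carrier (residue_ring (int p)) - {\<zero>\<^bsub>residue_ring (int p)\<^esub>}"

text \<open>
  For nonzero \<open>x\<close>, the quotient of \<open>x\<close> by \<open>p ^ v\<close>, where \<open>v\<close> is the valuation of \<open>x\<close>, is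
  the unique \<open>y\<close> with \<open>x = p ^ v * y\<close>; see lemma \<open>padic_unit_part_unique\<close> below.
\<close>

definition padic_unit_part :: "nat \<Rightarrow> (nat \<Rightarrow> int) \<Rightarrow> nat \<Rightarrow> int" where
  "padic_unit_part p x =
    (THE y. y \<in> carrier (padic_ints p) \<and>
            x = padic_of_int p (int p ^ the_enat (padic_val p x)) \<otimes>\<^bsub>padic_ints p\<^esub> y)"

definition last_nonzero_digit :: "nat \<Rightarrow> (nat \<Rightarrow> int) \<Rightarrow> int" where
  "last_nonzero_digit p x =
    (if x = \<zero>\<^bsub>padic_ints p\<^esub> then \<one>\<^bsub>residue_ring (int p)\<^esub>
     else padic_reduce (padic_unit_part p x))"

text \<open>The p-adic integer \<open>A * n + B * m + C\<close>.\<close>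

definition padic_affine ::
  "nat \<Rightarrow> (nat \<Rightarrow> int) \<Rightarrow> (nat \<Rightarrow> int) \<Rightarrow> (nat \<Rightarrow> int) \<Rightarrow> int \<Rightarrow> int \<Rightarrow> nat \<Rightarrow> int" where
  "padic_affine p A B C n m =
    A \<otimes>\<^bsub>padic_ints p\<^esub> padic_of_int p n \<oplus>\<^bsub>padic_ints p\<^esub> B \<otimes>\<^bsub>padic_ints p\<^esub> padic_of_int p m
      \<oplus>\<^bsub>padic_ints p\<^esub> C"

section \<open>Sudoku solutions\<close>

definition board :: "nat \<Rightarrow> (int \<times> int) set" where
  "board N = {0..<int N} \<times> UNIV"

text \<open>
  Functions on \<open>{0, \<dots>, N - 1}\<close> and on the board are represented by total functions whose values
  elsewhere are irrelevant.
\<close>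

definition sudoku_rule :: "nat \<Rightarrow> nat \<Rightarrow> (int \<Rightarrow> int) set" where
  "sudoku_rule p N =
    {g \<in> {0..<int N} \<rightarrow> nonzero_residues p.
      \<exists>a b :: int. \<not> (int p dvd a \<and> int p dvd b) \<and>
        (\<forall>n\<in>{0..<int N}. padic_val p (padic_of_int p (a * n + b)) \<le> 1 \<longrightarrow>
           g n = last_nonzero_digit p (padic_of_int p (a * n + b)))}"

definition sudoku_solution :: "nat \<Rightarrow> nat \<Rightarrow> (int \<times> int \<Rightarrow> int) \<Rightarrow> bool" where
  "sudoku_solution p N F \<longleftrightarrow>
    F \<in> board N \<rightarrow> nonzero_residues p \<and>
    (\<forall>j i :: int. (\<lambda>n. F (n, j * n + i)) \<in> sudoku_rule p N)"

definition nonconstant_columns :: "nat \<Rightarrow> (int \<times> int \<Rightarrow> int) \<Rightarrow> bool" where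
  "nonconstant_columns N F \<longleftrightarrow>
    (\<forall>n\<in>{0..<int N}. \<not> (\<exists>c. \<forall>m :: int. F (n, m) = c))"

section \<open>The notions above are well-defined\<close>

lemma padic_ints_simps:
  "x \<in> carrier (padic_ints p) \<longleftrightarrow>
     (\<forall>k. x k \<in> {0..<int p ^ k} \<and> x (Suc k) mod int p ^ k = x k)"
  "x \<otimes>\<^bsub>padic_ints p\<^esub> y = (\<lambda>k. (x k * y k) mod int p ^ k)"
  "x \<oplus>\<^bsub>padic_ints p\<^esub> y = (\<lambda>k. (x k + y k) mod int p ^ k)"
  "\<one>\<^bsub>padic_ints p\<^esub> = (\<lambda>k. 1 mod int p ^ k)"
  "\<zero>\<^bsub>padic_ints p\<^esub> = (\<lambda>k. 0)"
  by (simp_all add: padic_ints_def)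

lemma padic_of_int_closed:
  assumes "p > 0"
  shows "padic_of_int p n \<in> carrier (padic_ints p)"
  using assms by (simp add: padic_ints_simps padic_of_int_def mod_mod_cancel)

lemma padic_coord_mod:
  assumes "x \<in> carrier (padic_ints p)"
  shows "x k mod int p ^ k = x k" and "x (j + k) mod int p ^ k = x k"
proof -
  show *: "x k mod int p ^ k = x k" for k
    using assms by (simp add: padic_ints_simps)
  show "x (j + k) mod int p ^ k = x k"
  proof (induction j)
    case 0
    show ?case by (simp add: *)
  next
    case (Suc j)
    have "x (Suc (j + k)) mod int p ^ k = x (Suc (j + k)) mod int p ^ (j + k) mod int p ^ k"
      by (simp add: mod_mod_cancel power_add)
    also have "\<dots> = x (j + k) mod int p ^ k"
      using assms by (simp add: padic_ints_simps)
    finally show ?case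
      using Suc by simp
  qed
qed

lemma padic_closed:
  assumes "p > 0" "x \<in> carrier (padic_ints p)" "y \<in> carrier (padic_ints p)"
  shows "x \<otimes>\<^bsub>padic_ints p\<^esub> y \<in> carrier (padic_ints p)"
    and "x \<oplus>\<^bsub>padic_ints p\<^esub> y \<in> carrier (padic_ints p)"
proof -
  have x: "x (Suc k) mod int p ^ k = x k" and y: "y (Suc k) mod int p ^ k = y k" for k
    using assms by (simp_all add: padic_ints_simps)
  have "x (Suc k) * y (Suc k) mod int p ^ Suc k mod int p ^ k = x k * y k mod int p ^ k" for k
    using x[of k] y[of k] by (metis dvd_triv_right mod_mod_cancel mod_mult_eq power_Suc)
  then show "x \<otimes>\<^bsub>padic_ints p\<^esub> y \<in> carrier (padic_ints p)"
    using assms(1) by (simp add: padic_ints_simps)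
  have "(x (Suc k) + y (Suc k)) mod int p ^ Suc k mod int p ^ k = (x k + y k) mod int p ^ k" for k
    using x[of k] y[of k] by (metis dvd_triv_right mod_mod_cancel mod_add_eq power_Suc)
  then show "x \<oplus>\<^bsub>padic_ints p\<^esub> y \<in> carrier (padic_ints p)"
    using assms(1) by (simp add: padic_ints_simps)
qed

lemma padic_ints_cring:
  assumes "p > 0"
  shows "cring (padic_ints p)"
proof (rule cringI)
  note closed = padic_closed[OF assms]
  note simps = padic_ints_simps(2-5) padic_coord_mod mod_simps ac_simps
  have zero_one: "\<zero>\<^bsub>padic_ints p\<^esub> \<in> carrier (padic_ints p)" "\<one>\<^bsub>padic_ints p\<^esub> \<in> carrier (padic_ints p)"
    using assms by (simp_all add: padic_ints_simps mod_mod_cancel)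
  show "abelian_group (padic_ints p)"
  proof (rule abelian_groupI)
    fix x assume x: "x \<in> carrier (padic_ints p)"
    let ?y = "padic_of_int p (- 1) \<otimes>\<^bsub>padic_ints p\<^esub> x"
    have "?y \<in> carrier (padic_ints p)"
      using assms x by (intro closed padic_of_int_closed)
    moreover have "?y \<oplus>\<^bsub>padic_ints p\<^esub> x = \<zero>\<^bsub>padic_ints p\<^esub>"
      by (rule ext) (simp add: padic_ints_simps padic_of_int_def mod_simps)
    ultimately show "\<exists>y\<in>carrier (padic_ints p). y \<oplus>\<^bsub>padic_ints p\<^esub> x = \<zero>\<^bsub>padic_ints p\<^esub>"
      by blast
  qed (simp_all add: closed zero_one, simp_all add: simps)
  show "comm_monoid (padic_ints p)"
    by (rule comm_monoidI) (simp_all add: closed zero_one, simp_all add: simps)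
qed (simp add: padic_ints_simps mod_simps algebra_simps)

lemma padic_p_power_dvd_iff:
  assumes "p > 1" "x \<in> carrier (padic_ints p)"
  shows "padic_of_int p (int p ^ k) divides\<^bsub>padic_ints p\<^esub> x \<longleftrightarrow> x k = 0"
proof
  assume "padic_of_int p (int p ^ k) divides\<^bsub>padic_ints p\<^esub> x"
  then show "x k = 0"
    by (auto simp: factor_def padic_ints_simps padic_of_int_def)
next
  assume xk: "x k = 0"
  define y where "y = (\<lambda>j. x (j + k) div int p ^ k)"
  have dvd: "int p ^ k dvd x (j + k)" for j
    using padic_coord_mod(2)[OF assms(2), of j k] xk by auto
  then have xy: "x (j + k) = int p ^ k * y j" for j
    by (simp add: y_def)
  have xpos: "x (j + k) \<in> {0..<int p ^ (j + k)}" for j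
    using assms(2) by (simp add: padic_ints_simps)
  have "y j \<in> {0..<int p ^ j}" for j
  proof -
    have "0 \<le> int p ^ k * y j" "int p ^ k * y j < int p ^ k * int p ^ j"
      using xpos[of j] by (auto simp: xy power_add mult.commute)
    moreover have "0 < int p ^ k"
      using assms(1) by simp
    ultimately show ?thesis
      by (simp add: zero_le_mult_iff)
  qed
  moreover have "y (Suc j) mod int p ^ j = y j" for j
  proof -
    have "x (Suc (j + k)) mod int p ^ (j + k) = x (j + k)"
      using assms(2) by (simp add: padic_ints_simps)
    then have "(int p ^ k * y (Suc j)) mod (int p ^ k * int p ^ j) = int p ^ k * y j"
      using xy[of "Suc j"] xy[of j] by (simp add: power_add mult.commute)
    then show ?thesis
      using assms(1) by (simp flip: mult_mod_right)
  qed
  ultimately have y: "y \<in> carrier (padic_ints p)"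
    by (simp add: padic_ints_simps)
  have "x = padic_of_int p (int p ^ k) \<otimes>\<^bsub>padic_ints p\<^esub> y"
  proof
    fix j
    have "x (k + j) mod int p ^ j = x j"
      by (rule padic_coord_mod(2)[OF assms(2)])
    moreover have "x (k + j) = int p ^ k * y j"
      using xy[of j] by (simp add: add.commute)
    ultimately show "x j = (padic_of_int p (int p ^ k) \<otimes>\<^bsub>padic_ints p\<^esub> y) j"
      by (simp add: padic_ints_simps padic_of_int_def mod_simps)
  qed
  then show "padic_of_int p (int p ^ k) divides\<^bsub>padic_ints p\<^esub> x"
    using y by (auto simp: factor_def)
qed

lemma padic_val_eq_enat_iff:
  assumes "p > 1" "x \<in> carrier (padic_ints p)"
  shows "padic_val p x = enat k \<longleftrightarrow> x k = 0 \<and> x (Suc k) \<noteq> 0"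
proof -
  let ?P = "\<lambda>k. x k = 0"
  have down: "?P i" if "?P j" "i \<le> j" for i j
    using padic_coord_mod(2)[OF assms(2), of "j - i" i] that by simp
  have x0: "?P 0"
    using padic_coord_mod(1)[OF assms(2), of 0] by simp
  have val: "padic_val p x = (if x = (\<lambda>k. 0) then \<infinity> else enat (Greatest ?P))"
    using padic_p_power_dvd_iff[OF assms]
    by (simp add: padic_val_def padic_ints_simps(5))
  show ?thesis
  proof (cases "x = (\<lambda>k. 0)")
    case True
    then have "padic_val p x = \<infinity>"
      using val by simp
    then show ?thesis
      using True by simp
  next
    case False
    then obtain n where n: "x n \<noteq> 0" by auto
    then have bound: "\<forall>i. ?P i \<longrightarrow> i \<le> n"
      using down by (meson nat_le_linear)
    have great: "?P (Greatest ?P)"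
      using GreatestI_nat[where P = ?P and k = 0 and b = n] x0 bound by blast
    have le: "i \<le> Greatest ?P" if "?P i" for i
      using Greatest_le_nat[where P = ?P and k = i and b = n] that bound by blast
    have "Greatest ?P = k \<longleftrightarrow> ?P k \<and> \<not> ?P (Suc k)"
      using great le down by (metis Suc_n_not_le_n le_antisym not_less_eq_eq)
    then show ?thesis
      using False by (simp add: val)
  qed
qed

lemma padic_quotient_coord:
  assumes "w \<in> carrier (padic_ints p)"
    and "x = padic_of_int p (int p ^ k) \<otimes>\<^bsub>padic_ints p\<^esub> w"
  shows "x (k + j) = int p ^ k * w j"
proof -
  have "x (k + j) = int p ^ k * w (k + j) mod (int p ^ k * int p ^ j)"
    by (subst assms(2)) (simp add: padic_ints_simps padic_of_int_def mod_simps power_add)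
  also have "\<dots> = int p ^ k * (w (k + j) mod int p ^ j)"
    by (simp flip: mult_mod_right)
  finally show ?thesis
    using padic_coord_mod(2)[OF assms(1)] by simp
qed

lemma padic_unit_part_unique:
  assumes "p > 1" "x \<in> carrier (padic_ints p)" "x \<noteq> \<zero>\<^bsub>padic_ints p\<^esub>"
  shows "\<exists>!y. y \<in> carrier (padic_ints p) \<and>
           x = padic_of_int p (int p ^ the_enat (padic_val p x)) \<otimes>\<^bsub>padic_ints p\<^esub> y"
proof (rule ex_ex1I)
  let ?k = "the_enat (padic_val p x)"
  have "padic_val p x = enat ?k"
    using assms(3) by (simp add: padic_val_def)
  then have "x ?k = 0"
    using padic_val_eq_enat_iff[OF assms(1,2)] by blast
  then show "\<exists>y. y \<in> carrier (padic_ints p) \<and>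
      x = padic_of_int p (int p ^ ?k) \<otimes>\<^bsub>padic_ints p\<^esub> y"
    using padic_p_power_dvd_iff[OF assms(1,2)] by (auto simp: factor_def)
  fix y z
  assume y: "y \<in> carrier (padic_ints p) \<and>
      x = padic_of_int p (int p ^ ?k) \<otimes>\<^bsub>padic_ints p\<^esub> y"
    and z: "z \<in> carrier (padic_ints p) \<and>
      x = padic_of_int p (int p ^ ?k) \<otimes>\<^bsub>padic_ints p\<^esub> z"
  have "int p ^ ?k * y j = int p ^ ?k * z j" for j
    using padic_quotient_coord y z by metis
  then show "y = z"
    using assms(1) by (intro ext) simp
qed

lemma last_nonzero_digit_in_nonzero_residues:
  assumes "p > 1" "x \<in> carrier (padic_ints p)"
  shows "last_nonzero_digit p x \<in> nonzero_residues p"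
proof (cases "x = \<zero>\<^bsub>padic_ints p\<^esub>")
  case True
  then show ?thesis
    using assms(1) by (simp add: last_nonzero_digit_def nonzero_residues_def residue_ring_def)
next
  case False
  let ?k = "the_enat (padic_val p x)" and ?y = "padic_unit_part p x"
  have y: "?y \<in> carrier (padic_ints p)"
    "x = padic_of_int p (int p ^ ?k) \<otimes>\<^bsub>padic_ints p\<^esub> ?y"
    using theI'[OF padic_unit_part_unique[OF assms False]] unfolding padic_unit_part_def by blast+
  have "padic_val p x = enat ?k"
    using False by (simp add: padic_val_def)
  then have "x (?k + 1) \<noteq> 0"
    using padic_val_eq_enat_iff[OF assms] by simp
  then have "?y 1 \<noteq> 0"
    using padic_quotient_coord[OF y, of 1] by auto
  moreover have "?y 1 \<in> {0..<int p ^ 1}"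
    using y(1) unfolding padic_ints_simps by blast
  ultimately show ?thesis
    using False by (auto simp: last_nonzero_digit_def padic_reduce_def nonzero_residues_def
        residue_ring_def)
qed

end

theory Submission
  imports Defs
begin

text \<open>
  Along a line of slope \<open>j\<close> a solution equals an affine function \<open>a n + b\<close> modulo \<open>p\<close> except in one residue
  class of columns, where the line is singular. By averaging there are five consecutive columns and a
  large box of lines few of which are singular there. For most lines the values in three consecutive
  columns are then in arithmetic progression. Comparing two lines through a common point in
  an outer column shows that \<open>F (n, m + t) - F (n, m)\<close> is, for most \<open>m\<close>, a constant additive in \<open>t\<close>, so in
  some window three adjacent columns mostly agree with an affine form modulo \<open>p\<close>. A line that agrees
  with the form in three columns agrees with it everywhere, up to zeros of the form, and this spreads the agreement
  from the window to the whole board. Non-constant columns force the coefficient \<open>B\<close> of \<open>m\<close>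
  to be a unit.

  On the zeros of the form one substitutes \<open>m = p m' + \<alpha> n + \<gamma>\<close>. The result is again a solution, and
  the values of valuation one of the rule show that its columns are non-constant and that it has the same \<open>B\<close>.
  Iterating yields the digits of \<open>A\<close> and \<open>C\<close>.
\<close>

section \<open>Counting\<close>

text \<open>The rule does not relate the pairs \<open>a\<close>, \<open>b\<close> of different
  lines, and each line may be singular in a column of its own choice. No triple of columns is safe
  for all lines, so the argument modulo \<open>p\<close> has to tolerate a positive proportion of
  errors. The weights are tuned to one threshold: the exceptions in the three columns together must
  stay below a quarter of a window.

  On the zeros, one integer \<open>B\<close> can serve at all levels: multiplying \<open>A\<close>,
  \<open>B\<close>, \<open>C\<close> by a p-adic integer congruent to 1 modulo \<open>p\<close> does
  not change the last nonzero digit of a nonzero value, so \<open>B\<close> can be normalised to an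
  ordinary integer. The p-adic information is then carried by the line of zeros
  \<open>m = a n + c\<close> alone; \<open>a\<close> and \<open>c\<close> are limits of the shifts
  used in the substitutions, and \<open>A = - B a\<close>, \<open>C = - B c\<close>.\<close>

lemma exists_sum_le_average:
  fixes g :: "'a \<Rightarrow> real" and c :: real
  assumes "finite S" "S \<noteq> {}" "sum g S \<le> c * real (card S)"
  shows "\<exists>s\<in>S. g s \<le> c"
proof (rule ccontr)
  assume "\<not> ?thesis"
  then have "sum (\<lambda>_. c) S < sum g S"
    using assms(1,2) by (intro sum_strict_mono) auto
  then show False
    using assms(3) by (simp add: mult.commute)
qed

lemma exists_fibre_card_le:
  assumes "finite U" "U \<noteq> {}" "finite X" "card {(u, x). u \<in> U \<and> x \<in> X \<and> P u x} \<le> K"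
  shows "\<exists>u\<in>U. card {x \<in> X. P u x} * card U \<le> K"
proof -
  have "{(u, x). u \<in> U \<and> x \<in> X \<and> P u x} = Sigma U (\<lambda>u. {x \<in> X. P u x})"
    by auto
  then have "(\<Sum>u\<in>U. card {x \<in> X. P u x}) \<le> K"
    using assms by simp
  then have "(\<Sum>u\<in>U. real (card {x \<in> X. P u x})) \<le> (K / card U) * card U"
    using assms(1,2) by (simp flip: of_nat_sum)
  then obtain u where "u \<in> U" "real (card {x \<in> X. P u x}) \<le> K / card U"
    using exists_sum_le_average assms(1,2) by meson
  moreover from this have "real (card {x \<in> X. P u x} * card U) \<le> real K"
    using assms(1,2) by (simp add: field_simps card_gt_0_iff)
  ultimately show ?thesis
    using of_nat_le_iff by blast
qed

text \<open>
  If \<open>\<phi> u - 2 \<chi> x + \<psi> (2 x - u)\<close> vanishes for most \<open>(u, x)\<close>, then comparing \<open>(u, x)\<close> with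
  \<open>(u + 2 t, x + t)\<close> eliminates \<open>\<psi>\<close>.
\<close>

lemma exists_shift_relation:
  fixes \<phi> \<psi> \<chi> :: "int \<Rightarrow> int" and p t :: int
  assumes E: "finite S" "card S \<le> E"
    and S: "\<And>u x. u \<in> U \<Longrightarrow> x \<in> X \<Longrightarrow> \<not> [\<phi> u + \<psi> (2 * x - u) = 2 * \<chi> x] (mod p) \<Longrightarrow> (u, x) \<in> S"
      "\<And>u x. u \<in> U \<Longrightarrow> x \<in> X \<Longrightarrow>
         \<not> [\<phi> (u + 2 * t) + \<psi> (2 * (x + t) - (u + 2 * t)) = 2 * \<chi> (x + t)] (mod p) \<Longrightarrow>
         (u + 2 * t, x + t) \<in> S"
  shows "card {(u, x). u \<in> U \<and> x \<in> X \<and>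
           \<not> [\<phi> (u + 2 * t) - \<phi> u = 2 * (\<chi> (x + t) - \<chi> x)] (mod p)} \<le> 2 * E" (is "card ?A \<le> _")
proof -
  let ?s = "\<lambda>(u, x). (u - 2 * t, x - t)"
  have "?A \<subseteq> S \<union> ?s ` S"
  proof
    fix z assume "z \<in> ?A"
    then obtain u x where z: "z = (u, x)" "u \<in> U" "x \<in> X"
      and n: "\<not> [\<phi> (u + 2 * t) - \<phi> u = 2 * (\<chi> (x + t) - \<chi> x)] (mod p)"
      by auto
    have "z \<in> S" if "z \<notin> ?s ` S"
    proof (rule ccontr)
      assume "z \<notin> S"
      then have 1: "[\<phi> u + \<psi> (2 * x - u) = 2 * \<chi> x] (mod p)"
        using S(1) z by blast
      have "(u + 2 * t, x + t) \<notin> S"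
        using that z(1) by force
      then have 2: "[\<phi> (u + 2 * t) + \<psi> (2 * (x + t) - (u + 2 * t)) = 2 * \<chi> (x + t)] (mod p)"
        using S(2) z by blast
      have "2 * (x + t) - (u + 2 * t) = 2 * x - u"
        by simp
      with cong_diff[OF 2 1] have
        "[\<phi> (u + 2 * t) - \<phi> u = 2 * (\<chi> (x + t) - \<chi> x)] (mod p)"
        by (simp add: algebra_simps)
      then show False using n by blast
    qed
    then show "z \<in> S \<union> ?s ` S" by blast
  qed
  then have "card ?A \<le> card (S \<union> ?s ` S)"
    using E(1) by (intro card_mono) auto
  also have "\<dots> \<le> card S + card (?s ` S)"
    by (rule card_Un_le)
  also have "\<dots> \<le> 2 * E"
    using card_image_le[OF E(1), of ?s] E(2) by simp
  finally show ?thesis .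
qed

text \<open>A shift by \<open>t + 1\<close> is a shift by 1 followed by a shift by \<open>t\<close>.
  The exceptions for \<open>1\<close>, \<open>t\<close> and \<open>t + 1\<close> number at most
  \<open>3 r\<close> in all, too few to cover the points \<open>x\<close> with both \<open>x\<close>
  and \<open>x + 1\<close> in the interval; at an uncovered point the three increments add
  up.\<close>

lemma almost_additive_imp_linear:
  fixes \<phi> d :: "int \<Rightarrow> int" and a b :: int and n r :: nat
  assumes bad: "\<And>t. t \<le> n \<Longrightarrow> card {x \<in> {a..<b}. \<not> [\<phi> (x + int t) - \<phi> x = d (int t)] (mod p)} \<le> r"
    and r: "3 * int r + 1 < b - a"
    and "t \<le> n" "n \<ge> 1"
  shows "[d (int t) = int t * d 1] (mod p)"
  using assms(3)
proof (induction t)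
  case 0
  let ?A = "{x \<in> {a..<b}. \<not> [\<phi> (x + int 0) - \<phi> x = d (int 0)] (mod p)}"
  have "\<not> {a..<b} \<subseteq> ?A"
  proof
    assume "{a..<b} \<subseteq> ?A"
    then have "card {a..<b} \<le> card ?A"
      by (rule card_mono[rotated]) (rule finite_subset[of _ "{a..<b}"], auto)
    also have "\<dots> \<le> r" using bad[of 0] by blast
    finally show False using r by simp
  qed
  then show ?case by (auto simp: cong_sym_eq)
next
  case (Suc t)
  let ?A = "\<lambda>t. {x \<in> {a..<b}. \<not> [\<phi> (x + int t) - \<phi> x = d (int t)] (mod p)}"
  have fin: "finite (?A t)" for t
    by (rule finite_subset[of _ "{a..<b}"]) auto
  have "\<not> {a..<b - 1} \<subseteq> ?A 1 \<union> (\<lambda>x. x - 1) ` ?A t \<union> ?A (Suc t)"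
  proof
    assume "{a..<b - 1} \<subseteq> ?A 1 \<union> (\<lambda>x. x - 1) ` ?A t \<union> ?A (Suc t)"
    then have "card {a..<b - 1} \<le> card (?A 1 \<union> (\<lambda>x. x - 1) ` ?A t \<union> ?A (Suc t))"
      by (rule card_mono[rotated]) (intro finite_UnI finite_imageI fin)
    also have "\<dots> \<le> card (?A 1) + card ((\<lambda>x. x - 1) ` ?A t) + card (?A (Suc t))"
      using card_Un_le[of "?A 1 \<union> (\<lambda>x. x - 1) ` ?A t" "?A (Suc t)"]
        card_Un_le[of "?A 1" "(\<lambda>x. x - 1) ` ?A t"] by linarith
    also have "\<dots> \<le> card (?A 1) + card (?A t) + card (?A (Suc t))"
      using card_image_le[OF fin[of t], of "\<lambda>x. x - 1"] by linarith
    also have "\<dots> \<le> r + r + r"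
      using bad[of 1] bad[of t] bad[of "Suc t"] Suc.prems assms(4) by linarith
    finally show False using r by simp
  qed
  then obtain x where x: "a \<le> x" "x < b - 1" "x \<notin> ?A 1" "x \<notin> (\<lambda>x. x - 1) ` ?A t" "x \<notin> ?A (Suc t)"
    unfolding subset_iff Un_iff atLeastLessThan_iff by blast
  have "x + 1 \<notin> ?A t"
    using x(4) image_eqI[of x "\<lambda>x. x - 1" "x + 1" "?A t"] by auto
  then have 1: "[\<phi> (x + 1 + int t) - \<phi> (x + 1) = d (int t)] (mod p)"
    using x by auto
  have 2: "[\<phi> (x + 1) - \<phi> x = d 1] (mod p)" "[\<phi> (x + 1 + int t) - \<phi> x = d (int (Suc t))] (mod p)"
    using x by (auto simp: algebra_simps)
  have "[d (int (Suc t)) = d 1 + d (int t)] (mod p)"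
    using cong_add[OF 2(1) 1] cong_sym[OF 2(2)] by (simp add: cong_def)
  also have "[d 1 + d (int t) = d 1 + int t * d 1] (mod p)"
    using Suc by (intro cong_add) auto
  finally show ?case
    by (simp add: algebra_simps)
qed

text \<open>
  The constants come from \<open>2 b (1 - b)\<close>, which bounds the proportion of unequal pairs from below when a
  proportion \<open>b \<le> 1 / 2\<close> of the values differs from the most frequent one, and equals \<open>3 / 8\<close> at
  \<open>b = 1 / 4\<close>.
\<close>

lemma exists_modal_value:
  fixes \<psi> :: "'a \<Rightarrow> int" and p :: int
  assumes W: "finite W" "W \<noteq> {}"
    and D: "D = card {(t, t'). t \<in> W \<and> t' \<in> W \<and> \<not> [\<psi> t = \<psi> t'] (mod p)}"
    and small: "real D < 3 / 8 * real (card W) ^ 2"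
  shows "\<exists>v. real (card {t \<in> W. \<not> [\<psi> t = v] (mod p)}) * card W \<le> 2 / 3 * D"
proof -
  obtain u where u: "u \<in> W" "card {t' \<in> W. \<not> [\<psi> u = \<psi> t'] (mod p)} * card W \<le> D"
    using exists_fibre_card_le[OF W W(1), of "\<lambda>t t'. \<not> [\<psi> t = \<psi> t'] (mod p)" D] D by auto
  define A where "A = {t \<in> W. \<not> [\<psi> t = \<psi> u] (mod p)}"
  define n b where "n = real (card W)" and "b = real (card A)"
  have n: "n > 0" using W by (simp add: n_def card_gt_0_iff)
  have AW: "A \<subseteq> W" "finite A" using W by (auto simp: A_def)
  have cWA: "real (card (W - A)) = n - b"
    using AW W by (simp add: n_def b_def card_Diff_subset card_mono of_nat_diff)
  have "{t' \<in> W. \<not> [\<psi> u = \<psi> t'] (mod p)} = A"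
    by (auto simp: A_def cong_sym_eq)
  with u have bn: "b * n \<le> D"
    by (metis b_def n_def of_nat_le_iff of_nat_mult)
  have "A \<times> (W - A) \<union> (W - A) \<times> A \<subseteq> {(t, t'). t \<in> W \<and> t' \<in> W \<and> \<not> [\<psi> t = \<psi> t'] (mod p)}"
  proof -
    have "\<not> [\<psi> t = \<psi> t'] (mod p)" "\<not> [\<psi> t' = \<psi> t] (mod p)" if "t \<in> A" "t' \<in> W - A" for t t'
    proof -
      have "[\<psi> t' = \<psi> u] (mod p)" "\<not> [\<psi> t = \<psi> u] (mod p)"
        using that by (auto simp: A_def)
      then show "\<not> [\<psi> t = \<psi> t'] (mod p)" "\<not> [\<psi> t' = \<psi> t] (mod p)"
        unfolding cong_def by simp_all
    qed
    then show ?thesis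
      using AW by blast
  qed
  then have "card (A \<times> (W - A) \<union> (W - A) \<times> A) \<le> D"
    unfolding D by (intro card_mono) (auto intro: finite_subset[of _ "W \<times> W"] simp: W)
  also have "card (A \<times> (W - A) \<union> (W - A) \<times> A) = card A * card (W - A) + card (W - A) * card A"
    using AW W by (subst card_Un_disjoint) (auto simp: card_cartesian_product)
  finally have "real (card A * card (W - A) + card (W - A) * card A) \<le> real D"
    using of_nat_le_iff by blast
  then have pairs: "2 * b * (n - b) \<le> D"
    by (simp add: cWA b_def)
  have b3: "b < 3 / 8 * n"
  proof -
    have "b * n < (3 / 8 * n) * n"
      using bn small by (simp add: n_def power2_eq_square)
    then show ?thesis
      using n by (simp only: mult_less_cancel_right_pos)
  qed
  \<comment> \<open>\<open>2 b (n - b)\<close> is at least \<open>3 / 8 n ^ 2\<close> for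
    \<open>b\<close> between \<open>n / 4\<close> and \<open>3 n / 4\<close>, so the crude bound
    \<open>b < 3 / 8 n\<close> improves to \<open>b < n / 4\<close>. Then \<open>n - b\<close>
    exceeds \<open>3 / 4 n\<close>, which produces the factor \<open>2 / 3\<close>.\<close>
  have "b < n / 4"
  proof (rule ccontr)
    assume "\<not> b < n / 4"
    then have "0 \<le> (b - n / 4) * (3 * n / 4 - b)"
      using b3 by (intro mult_nonneg_nonneg) auto
    then have "3 / 8 * n ^ 2 \<le> 2 * b * (n - b)"
      by (simp add: field_simps power2_eq_square)
    then show False using pairs small by (simp add: n_def)
  qed
  then have "b * (3 / 4 * n) \<le> b * (n - b)"
    by (intro mult_left_mono) (auto simp: b_def)
  then have "b * n \<le> 2 / 3 * D"
    using pairs by simp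
  then show ?thesis
    unfolding b_def n_def A_def by blast
qed

text \<open>For a fixed \<open>u\<close> the relation makes
  \<open>2 * (\<chi> (x + t) - \<chi> x)\<close> independent of \<open>x\<close>, and 2 is
  invertible modulo an odd \<open>p\<close>. It suffices to take a \<open>u\<close> with at most the
  average number of exceptions.\<close>

lemma exists_popular_difference:
  fixes \<phi> \<psi> \<chi> :: "int \<Rightarrow> int" and p t :: int
  assumes "odd p" and fin: "finite U" "U \<noteq> {}" "finite X"
    and E: "card {(u, x). u \<in> U \<and> x \<in> X \<and>
           \<not> [\<phi> (u + 2 * t) - \<phi> u = 2 * (\<chi> (x + t) - \<chi> x)] (mod p)} \<le> E"
  shows "\<exists>d. card {x \<in> X. \<not> [\<chi> (x + t) - \<chi> x = d] (mod p)} * card U \<le> E"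
proof -
  let ?P = "\<lambda>u x. \<not> [\<phi> (u + 2 * t) - \<phi> u = 2 * (\<chi> (x + t) - \<chi> x)] (mod p)"
  obtain u where u: "u \<in> U" "card {x \<in> X. ?P u x} * card U \<le> E"
    using exists_fibre_card_le[OF fin, of ?P E] E by auto
  \<comment> \<open>If every \<open>x\<close> is exceptional for \<open>u\<close>, the bound for
    \<open>u\<close> covers all of \<open>X\<close> and any \<open>d\<close> will do.\<close>
  obtain y where y: "y \<in> X \<and> \<not> ?P u y \<or> (\<forall>x\<in>X. ?P u x)"
    by blast
  have "{x \<in> X. \<not> [\<chi> (x + t) - \<chi> x = \<chi> (y + t) - \<chi> y] (mod p)} \<subseteq> {x \<in> X. ?P u x}"
  proof (rule ccontr)
    assume "\<not> ?thesis"
    then obtain x where x: "x \<in> X" "\<not> ?P u x" "\<not> [\<chi> (x + t) - \<chi> x = \<chi> (y + t) - \<chi> y] (mod p)"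
      by blast
    then have "\<not> ?P u y"
      using y by blast
    then have "[2 * (\<chi> (x + t) - \<chi> x) = 2 * (\<chi> (y + t) - \<chi> y)] (mod p)"
      using x(2) by (meson cong_sym cong_trans)
    moreover have "coprime 2 p"
      using assms(1) by simp
    ultimately show False
      using x(3) cong_mult_lcancel by blast
  qed
  then have "card {x \<in> X. \<not> [\<chi> (x + t) - \<chi> x = \<chi> (y + t) - \<chi> y] (mod p)} \<le> card {x \<in> X. ?P u x}"
    using fin by (intro card_mono) auto
  with u(2) show ?thesis
    by (meson le_trans mult_le_mono1)
qed

text \<open>Take a \<open>u\<close> with few exceptional \<open>x\<close>. If \<open>\<phi>\<close>
  has the right increment at \<open>u\<close>, cancelling 2 finishes the proof. Otherwise every
  \<open>x\<close> is exceptional for \<open>u\<close> or lies in \<open>Y\<close>. At least four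
  fifths of \<open>U\<close> have the right increment, and these paired with \<open>Y\<close> are
  all exceptional, so \<open>4 * card U * card Y \<le> 10 * E\<close>. Both facts together give
  \<open>2 * card U * card X \<le> 9 * E\<close>, which is excluded.\<close>

lemma transfer_slope:
  fixes \<phi> \<chi> :: "int \<Rightarrow> int" and p t :: int
  assumes "odd p" and fin: "finite U" "U \<noteq> {}" "finite X" "X \<noteq> {}"
    and E: "card {(u, x). u \<in> U \<and> x \<in> X \<and>
           \<not> [\<phi> (u + 2 * t) - \<phi> u = 2 * (\<chi> (x + t) - \<chi> x)] (mod p)} \<le> 2 * E"
    and bad: "5 * card {u \<in> U. \<not> [\<phi> (u + 2 * t) - \<phi> u = B * (2 * t)] (mod p)} \<le> card U"
    and small: "9 * E < 2 * (card U * card X)"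
  shows "card {x \<in> X. \<not> [\<chi> (x + t) - \<chi> x = B * t] (mod p)} * card U \<le> 2 * E"
proof -
  let ?P = "\<lambda>u x. \<not> [\<phi> (u + 2 * t) - \<phi> u = 2 * (\<chi> (x + t) - \<chi> x)] (mod p)"
  define Y where "Y = {x \<in> X. \<not> [\<chi> (x + t) - \<chi> x = B * t] (mod p)}"
  define V where "V = {u \<in> U. \<not> [\<phi> (u + 2 * t) - \<phi> u = B * (2 * t)] (mod p)}"
  have cancel: "[\<chi> (x + t) - \<chi> x = B * t] (mod p)"
    if "\<not> ?P u x" "[\<phi> (u + 2 * t) - \<phi> u = B * (2 * t)] (mod p)" for u x
  proof -
    have "[2 * (\<chi> (x + t) - \<chi> x) = 2 * (B * t)] (mod p)"
      using that unfolding cong_def by (simp add: algebra_simps)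
    moreover have "coprime 2 p"
      using \<open>odd p\<close> by simp
    ultimately show ?thesis
      using cong_mult_lcancel by blast
  qed
  obtain u where u: "u \<in> U" "card {x \<in> X. ?P u x} * card U \<le> 2 * E"
    using exists_fibre_card_le[OF fin(1-3), of ?P "2 * E"] E by auto
  show ?thesis
  proof (cases "u \<in> V")
    case False
    then have "[\<phi> (u + 2 * t) - \<phi> u = B * (2 * t)] (mod p)"
      using u by (auto simp: V_def)
    then have "Y \<subseteq> {x \<in> X. ?P u x}"
      unfolding Y_def using cancel by blast
    then have "card Y \<le> card {x \<in> X. ?P u x}"
      using fin by (intro card_mono) auto
    with u(2) show ?thesis
      unfolding Y_def by (meson le_trans mult_le_mono1)
  next
    case True
    then have nu: "\<not> [\<phi> (u + 2 * t) - \<phi> u = B * (2 * t)] (mod p)"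
      by (auto simp: V_def)
    have "X \<subseteq> {x \<in> X. ?P u x} \<union> Y"
    proof -
      have "x \<in> Y" if "x \<in> X" "\<not> ?P u x" for x
      proof (rule ccontr)
        assume "x \<notin> Y"
        then have "[2 * (\<chi> (x + t) - \<chi> x) = 2 * (B * t)] (mod p)"
          using that by (intro cong_scalar_left) (auto simp: Y_def)
        then show False
          using that nu by (auto simp: algebra_simps intro: cong_trans)
      qed
      then show ?thesis by blast
    qed
    then have "card X \<le> card ({x \<in> X. ?P u x} \<union> Y)"
      using fin by (intro card_mono) (auto simp: Y_def)
    also have "\<dots> \<le> card {x \<in> X. ?P u x} + card Y"
      by (rule card_Un_le)
    finally have X: "card X \<le> card {x \<in> X. ?P u x} + card Y" .
    have "(U - V) \<times> Y \<subseteq> {(u, x). u \<in> U \<and> x \<in> X \<and> ?P u x}"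
      unfolding Y_def V_def using cancel by blast
    then have "card ((U - V) \<times> Y) \<le> card {(u, x). u \<in> U \<and> x \<in> X \<and> ?P u x}"
      using fin by (intro card_mono) (auto intro: finite_subset[of _ "U \<times> X"])
    also note E
    finally have "(card U - card V) * card Y \<le> 2 * E"
      using fin by (simp add: card_cartesian_product card_Diff_subset V_def)
    moreover have "4 * card U \<le> 5 * (card U - card V)"
      using bad by (simp add: V_def)
    ultimately have "4 * card U * card Y \<le> 10 * E"
      using mult_le_mono1[of "4 * card U" "5 * (card U - card V)" "card Y"] by linarith
    moreover have "card U * card X \<le> card U * card {x \<in> X. ?P u x} + card U * card Y"
      using mult_le_mono2[OF X, of "card U"] by (simp add: algebra_simps)
    ultimately have "2 * (card U * card X) \<le> 9 * E"
      using u(2) by (simp add: mult.commute)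
    then show ?thesis
      using small by linarith
  qed
qed

text \<open>Despite the name, the unequal pairs are counted. Unlike the frequency of a most frequent
  value, this number can be summed over base points \<open>x\<close> by exchanging sums;
  \<open>exists_modal_value\<close> returns to single values.\<close>

definition collisions :: "int \<Rightarrow> (int \<Rightarrow> int) \<Rightarrow> int \<Rightarrow> int \<Rightarrow> int \<Rightarrow> nat" where
  "collisions p \<phi> B H x =
    card {(t, t'). t \<in> {-H..H} \<and> t' \<in> {-H..H} \<and> \<not> [\<phi> (x + t) - B * t = \<phi> (x + t') - B * t'] (mod p)}"

lemma card_filter_eq_sum:
  "finite A \<Longrightarrow> real (card {x \<in> A. P x}) = (\<Sum>x\<in>A. of_bool (P x))"
  by (simp add: sum.If_cases of_bool_def Int_def)

text \<open>A pair \<open>t \<le> t'\<close> is counted at \<open>x\<close> exactly when the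
  increment of \<open>\<phi>\<close> at \<open>x + t\<close> over the distance \<open>t' - t\<close>
  is wrong. Each pair is thus counted for at most \<open>r\<close> base points; distances up to
  \<open>2 * H\<close> occur.\<close>

lemma sum_collisions_le:
  fixes \<phi> :: "int \<Rightarrow> int" and r :: real
  assumes fin: "finite X" and sub: "\<And>x t. x \<in> Y \<Longrightarrow> t \<in> {-H..H} \<Longrightarrow> x + t \<in> X"
    and bad: "\<And>t. t \<in> {0..2 * H} \<Longrightarrow> card {x \<in> X. \<not> [\<phi> (x + t) - \<phi> x = B * t] (mod p)} \<le> r"
    and "H > 0"
  shows "(\<Sum>x\<in>Y. real (collisions p \<phi> B H x)) \<le> r * real_of_int (2 * H + 1) ^ 2"
proof -
  define W where "W = {-H..H}"
  let ?N = "\<lambda>x t t'. \<not> [\<phi> (x + t) - B * t = \<phi> (x + t') - B * t'] (mod p)"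
  have finY: "finite Y"
    using finite_subset[of Y X] fin sub[of _ 0] \<open>H > 0\<close> by auto
  have ordered: "card {x \<in> Y. ?N x t t'} \<le> r" if t: "t \<in> W" "t' \<in> W" "t \<le> t'" for t t'
  proof -
    have "(\<lambda>x. x + t) ` {x \<in> Y. ?N x t t'} \<subseteq> {x \<in> X. \<not> [\<phi> (x + (t' - t)) - \<phi> x = B * (t' - t)] (mod p)}"
      using sub t by (auto simp: W_def cong_iff_dvd_diff algebra_simps dvd_diff_commute)
    then have "card ((\<lambda>x. x + t) ` {x \<in> Y. ?N x t t'}) \<le>
        card {x \<in> X. \<not> [\<phi> (x + (t' - t)) - \<phi> x = B * (t' - t)] (mod p)}"
      using fin by (intro card_mono) auto
    then have "real (card {x \<in> Y. ?N x t t'}) \<le>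
        card {x \<in> X. \<not> [\<phi> (x + (t' - t)) - \<phi> x = B * (t' - t)] (mod p)}"
      by (simp add: card_image inj_on_def)
    also have "\<dots> \<le> r"
      using t by (intro bad) (auto simp: W_def)
    finally show ?thesis .
  qed
  have each: "card {x \<in> Y. ?N x t t'} \<le> r" if "t \<in> W" "t' \<in> W" for t t'
    using ordered[of t t'] ordered[of t' t] that by (cases "t \<le> t'") (auto simp: cong_sym_eq)
  have "real (collisions p \<phi> B H x) = (\<Sum>z\<in>W \<times> W. of_bool (?N x (fst z) (snd z)))" for x
  proof -
    have "{(t, t'). t \<in> W \<and> t' \<in> W \<and> ?N x t t'} = {z \<in> W \<times> W. ?N x (fst z) (snd z)}"
      by auto
    then show ?thesis
      unfolding collisions_def W_def[symmetric]
      by (simp only: card_filter_eq_sum W_def finite_cartesian_product finite_atLeastAtMost_int)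
  qed
  then have "(\<Sum>x\<in>Y. real (collisions p \<phi> B H x)) =
      (\<Sum>x\<in>Y. \<Sum>z\<in>W \<times> W. of_bool (?N x (fst z) (snd z)))"
    by simp
  also have "\<dots> = (\<Sum>z\<in>W \<times> W. \<Sum>x\<in>Y. of_bool (?N x (fst z) (snd z)))"
    by (rule sum.swap)
  also have "\<dots> = (\<Sum>z\<in>W \<times> W. real (card {x \<in> Y. ?N x (fst z) (snd z)}))"
    by (simp only: card_filter_eq_sum finY)
  also have "\<dots> \<le> (\<Sum>z\<in>W \<times> W. r)"
    by (intro sum_mono each) auto
  also have "\<dots> = r * real_of_int (2 * H + 1) ^ 2"
    using \<open>H > 0\<close> by (simp add: W_def card_cartesian_product power2_eq_square algebra_simps)
  finally show ?thesis .
qed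

section \<open>Boxes of lines with few exceptions\<close>

text \<open>\<open>f k m\<close> is the entry in column \<open>k\<close> and row \<open>m\<close>
  relative to a chosen centre. A line is given by its height \<open>m\<close> in column 0 and its
  slope \<open>j\<close>; \<open>M\<close> heights and \<open>J\<close> slopes are averaged over,
  and \<open>H\<close> is the half-width of a window.\<close>

locale sampled_box =
  fixes p H M J :: int and f :: "int \<Rightarrow> int \<Rightarrow> int"
  assumes odd: "odd p" and pos: "H > 0" "M > 0" "J > 0"
begin

definition midpoint :: "int \<Rightarrow> int \<Rightarrow> int \<Rightarrow> bool" where
  "midpoint k m j \<longleftrightarrow>
    [f (k - 1) (m + (k - 1) * j) + f (k + 1) (m + (k + 1) * j) = 2 * f k (m + k * j)] (mod p)"

text \<open>The core is \<open>{0..<M} \<times> {0..<J}\<close>. The margins absorb shifts by up to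
  \<open>4 * H\<close> and, in the slope, the spread \<open>M\<close> of the heights; they are
  negligible once \<open>J\<close> is much larger than \<open>M\<close>, and \<open>M\<close> than
  \<open>H\<close>.\<close>

definition box :: "(int \<times> int) set" where
  "box = {- 6 * H..<M + 6 * H} \<times> {- (M + 10 * H)..<J + M + 10 * H}"

definition bad :: "int \<Rightarrow> (int \<times> int) set" where
  "bad k = {(m, j) \<in> box. \<not> midpoint k m j}"

lemma finite_bad: "finite (bad k)"
  by (rule finite_subset[of _ box]) (auto simp: bad_def box_def)

text \<open>The lines through a point \<open>u\<close> of column -1 meet column 0 at
  \<open>x\<close> with slope \<open>x - u\<close>, so \<open>exists_popular_difference\<close>
  yields an increment \<open>d t\<close> for column 0, and additivity makes \<open>d\<close> linear.
  Shifts up to \<open>4 * H\<close> are treated because the outer columns will compare their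
  increment over \<open>t\<close> with that of column 0 over \<open>2 * t\<close>.\<close>

lemma column_zero:
  assumes E: "35 * int (card (bad 0)) \<le> 3 * (M * J)"
  shows "\<exists>B. \<forall>t\<in>{0..4 * H}.
    int (card {m \<in> {- 2 * H..<M + 2 * H}. \<not> [f 0 (m + t) - f 0 m = B * t] (mod p)}) * J \<le> 2 * card (bad 0)"
proof -
  let ?U = "{- J..<0}" and ?X = "{- 2 * H..<M + 2 * H}"
  let ?N = "\<lambda>t d. card {m \<in> ?X. \<not> [f 0 (m + t) - f 0 m = d] (mod p)}"
  define S where "S = (\<lambda>(m, j). (m - j, m)) ` bad 0"
  have S: "(x - j, x) \<in> S" if "(x, j) \<in> box" "\<not> midpoint 0 x j" for x j
    unfolding S_def using that by (force simp: bad_def)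
  have "\<exists>d. ?N t d * card ?U \<le> 2 * card (bad 0)" if t: "t \<in> {0..4 * H}" for t
  proof (rule exists_popular_difference[OF odd], rule_tac [4] exists_shift_relation)
    show "finite S" "card S \<le> card (bad 0)"
      unfolding S_def by (simp_all add: finite_bad card_image_le)
    fix u x assume ux: "u \<in> ?U" "x \<in> ?X"
    show "(u, x) \<in> S" if "\<not> [f (- 1) u + f 1 (2 * x - u) = 2 * f 0 x] (mod p)"
      using S[of x "x - u"] that ux t pos by (auto simp: midpoint_def box_def algebra_simps)
    show "(u + 2 * t, x + t) \<in> S"
      if "\<not> [f (- 1) (u + 2 * t) + f 1 (2 * (x + t) - (u + 2 * t)) = 2 * f 0 (x + t)] (mod p)"
      using S[of "x + t" "x + t - (u + 2 * t)"] that ux t pos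
      by (auto simp: midpoint_def box_def algebra_simps)
  qed (use pos in auto)
  then have "\<forall>t. \<exists>d. t \<in> {0..4 * H} \<longrightarrow> ?N t d * card ?U \<le> 2 * card (bad 0)"
    by blast
  from choice[OF this] obtain d where "\<forall>t. t \<in> {0..4 * H} \<longrightarrow> ?N t (d t) * card ?U \<le> 2 * card (bad 0)" ..
  then have d: "?N t (d t) * card ?U \<le> 2 * card (bad 0)" if "t \<in> {0..4 * H}" for t
    using that by blast
  define r where "r = 2 * card (bad 0) div nat J"
  have dr: "?N t (d t) \<le> r" if "t \<in> {0..4 * H}" for t
    using d[OF that] pos by (simp add: r_def less_eq_div_iff_mult_less_eq)
  have "int (r * nat J) \<le> int (2 * card (bad 0))"
    unfolding of_nat_le_iff r_def by (rule div_times_less_eq_dividend)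
  then have "int r * J \<le> 2 * card (bad 0)"
    using pos by simp
  then have "35 * int r * J \<le> 6 * M * J"
    using E by simp
  then have "35 * int r \<le> 6 * M"
    using pos by simp
  \<comment> \<open>The factor 35 leaves ample room here: \<open>3 r\<close> is at most
    \<open>18 / 35 M\<close>.\<close>
  then have r: "3 * int r + 1 < (M + 2 * H) - (- 2 * H)"
    using pos by linarith
  have lin: "[d (int t) = int t * d 1] (mod p)" if "t \<le> nat (4 * H)" for t
  proof (rule almost_additive_imp_linear[OF _ r, of "nat (4 * H)" "f 0"])
    show "?N (int t) (d (int t)) \<le> r" if "t \<le> nat (4 * H)" for t
      using that pos by (intro dr) auto
  qed (use that pos in auto)
  have same: "?N t (d 1 * t) = ?N t (d t)" if "t \<in> {0..4 * H}" for t
  proof -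
    have "[d t = d 1 * t] (mod p)"
      using lin[of "nat t"] that by (simp add: mult.commute nat_mono)
    then show ?thesis
      by (simp add: cong_def)
  qed
  then have "int (?N t (d 1 * t)) * J \<le> 2 * card (bad 0)" if "t \<in> {0..4 * H}" for t
  proof -
    have "int (?N t (d t) * card ?U) \<le> int (2 * card (bad 0))"
      unfolding of_nat_le_iff by (rule d[OF that])
    then show ?thesis
      using same[OF that] pos by simp
  qed
  then show ?thesis
    by blast
qed

text \<open>The roles change: column 0 is now an outer column of the triple
  \<open>0, k, 2 * k\<close>, and its known slope is passed to the middle column \<open>k\<close>.
  This also ensures that all three columns share the same \<open>B\<close>.\<close>

lemma column_plus_minus:
  assumes k: "k = 1 \<and> X = {- 2 * H..<M + J + 2 * H} \<or> k = - 1 \<and> X = {- J - 2 * H..<M + 2 * H}"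
    and E0: "35 * int (card (bad 0)) \<le> 3 * (M * J)" and E: "16 * int (card (bad k)) < 3 * (M * J)"
    and B: "\<And>t. t \<in> {0..4 * H} \<Longrightarrow>
      int (card {m \<in> {- 2 * H..<M + 2 * H}. \<not> [f 0 (m + t) - f 0 m = B * t] (mod p)}) * J \<le> 2 * card (bad 0)"
    and t: "t \<in> {0..2 * H}"
  shows "int (card {x \<in> X. \<not> [f k (x + t) - f k x = B * t] (mod p)}) * M \<le> 2 * card (bad k)"
proof -
  let ?U = "{0..<M}"
  define S where "S = (\<lambda>(m, j). (m, m + k * j)) ` bad k"
  have S: "(u, u + k * j) \<in> S" if "(u, j) \<in> box" "\<not> midpoint k u j" for u j
    unfolding S_def using that by (force simp: bad_def)
  have X: "finite X" "J \<le> card X" "X \<noteq> {}"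
    using k pos by auto
  have "card {(u, x). u \<in> ?U \<and> x \<in> X \<and>
      \<not> [f 0 (u + 2 * t) - f 0 u = 2 * (f k (x + t) - f k x)] (mod p)} \<le> 2 * card (bad k)"
  proof (rule exists_shift_relation)
    show "finite S" "card S \<le> card (bad k)"
      unfolding S_def by (simp_all add: finite_bad card_image_le)
    fix u x assume ux: "u \<in> ?U" "x \<in> X"
    show "(u, x) \<in> S" if "\<not> [f 0 u + f (2 * k) (2 * x - u) = 2 * f k x] (mod p)"
      using S[of u "k * (x - u)"] that ux t pos k by (auto simp: midpoint_def box_def algebra_simps)
    show "(u + 2 * t, x + t) \<in> S"
      if "\<not> [f 0 (u + 2 * t) + f (2 * k) (2 * (x + t) - (u + 2 * t)) = 2 * f k (x + t)] (mod p)"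
      using S[of "u + 2 * t" "k * (x + t - (u + 2 * t))"] that ux t pos k
      by (auto simp: midpoint_def box_def algebra_simps)
  qed
  moreover have "5 * card {u \<in> ?U. \<not> [f 0 (u + 2 * t) - f 0 u = B * (2 * t)] (mod p)} \<le> card ?U"
  proof -
    let ?c = "card {u \<in> {- 2 * H..<M + 2 * H}. \<not> [f 0 (u + 2 * t) - f 0 u = B * (2 * t)] (mod p)}"
    have "35 * int ?c * J \<le> 6 * M * J"
      using B[of "2 * t"] E0 t by simp
    then have "35 * int ?c \<le> 6 * M"
      using pos by simp
    moreover have "card {u \<in> ?U. \<not> [f 0 (u + 2 * t) - f 0 u = B * (2 * t)] (mod p)} \<le> ?c"
      using pos by (intro card_mono) (auto intro: finite_subset[of _ "{- 2 * H..<M + 2 * H}"])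
    ultimately show ?thesis
      using pos by simp
  qed
  moreover have "9 * card (bad k) < 2 * (card ?U * card X)"
  proof -
    have "M * J \<le> M * card X"
      using X pos by (intro mult_left_mono) auto
    then have "9 * int (card (bad k)) < 2 * (M * card X)"
      using E by linarith
    also have "\<dots> = int (2 * (card ?U * card X))"
      using pos by simp
    finally show ?thesis
      by linarith
  qed
  ultimately have "card {x \<in> X. \<not> [f k (x + t) - f k x = B * t] (mod p)} * card ?U \<le> 2 * card (bad k)"
    using pos X by (intro transfer_slope[OF odd]) auto
  then have "int (card {x \<in> X. \<not> [f k (x + t) - f k x = B * t] (mod p)} * card ?U) \<le> int (2 * card (bad k))"
    by (simp only: of_nat_le_iff)
  then show ?thesis
    using pos by simp
qed

text \<open>For each \<open>i\<close> the sum over \<open>j\<close> costs \<open>E / card S\<close>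
  per pair of offsets; summing over \<open>S\<close> restores \<open>E\<close>. In the applications
  \<open>S\<close> is the coordinate that parametrised \<open>U\<close> in the bound for the
  column.\<close>

lemma sum_collisions_column_le:
  fixes E :: nat
  assumes S: "finite S" "S \<noteq> {}" "\<And>i j. i \<in> S \<Longrightarrow> j \<in> Y \<Longrightarrow> \<forall>t\<in>{-H..H}. g i j + t \<in> X"
    and inj: "\<And>i. i \<in> S \<Longrightarrow> inj_on (g i) Y" and X: "finite X"
    and bad: "\<And>t. t \<in> {0..2 * H} \<Longrightarrow> card {x \<in> X. \<not> [\<phi> (x + t) - \<phi> x = B * t] (mod p)} * card S \<le> E"
  shows "(\<Sum>i\<in>S. \<Sum>j\<in>Y. real (collisions p \<phi> B H (g i j))) \<le> E * real_of_int (2 * H + 1) ^ 2"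
proof -
  have S0: "real (card S) > 0"
    using S by (simp add: card_gt_0_iff)
  have "(\<Sum>j\<in>Y. real (collisions p \<phi> B H (g i j))) \<le> (E / card S) * real_of_int (2 * H + 1) ^ 2"
    if "i \<in> S" for i
  proof -
    have "(\<Sum>j\<in>Y. real (collisions p \<phi> B H (g i j))) = (\<Sum>x\<in>g i ` Y. real (collisions p \<phi> B H x))"
      using inj[OF that] by (simp add: sum.reindex)
    also have "\<dots> \<le> (E / card S) * real_of_int (2 * H + 1) ^ 2"
    proof (rule sum_collisions_le[OF X])
      fix t assume t: "t \<in> {0..2 * H}"
      have "real (card {x \<in> X. \<not> [\<phi> (x + t) - \<phi> x = B * t] (mod p)} * card S) \<le> real E"
        unfolding of_nat_le_iff by (rule bad[OF t])
      then show "real (card {x \<in> X. \<not> [\<phi> (x + t) - \<phi> x = B * t] (mod p)}) \<le> E / card S"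
        using S0 by (simp add: field_simps)
    qed (use S(3) that pos in auto)
    finally show ?thesis .
  qed
  then have "(\<Sum>i\<in>S. \<Sum>j\<in>Y. real (collisions p \<phi> B H (g i j))) \<le>
      (\<Sum>i\<in>S. (E / card S) * real_of_int (2 * H + 1) ^ 2)"
    by (rule sum_mono)
  also have "\<dots> = E * real_of_int (2 * H + 1) ^ 2"
    using S0 by simp
  finally show ?thesis .
qed

lemma sum_midpoint_failures_le:
  "(\<Sum>m\<in>{0..<M}. \<Sum>j\<in>{0..<J}. real (card {t \<in> {-H..H}. \<not> midpoint 0 (m + t) j}))
     \<le> card (bad 0) * real_of_int (2 * H + 1)"
proof -
  define S where "S = {0..<M} \<times> {0..<J}"
  let ?N = "\<lambda>z t. \<not> midpoint 0 (fst z + t) (snd z)"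
  have each: "card {z \<in> S. ?N z t} \<le> card (bad 0)" if "t \<in> {-H..H}" for t
  proof -
    have "(\<lambda>z. (fst z + t, snd z)) ` {z \<in> S. ?N z t} \<subseteq> bad 0"
      using that pos by (auto simp: S_def bad_def box_def)
    then have "card ((\<lambda>z. (fst z + t, snd z)) ` {z \<in> S. ?N z t}) \<le> card (bad 0)"
      by (intro card_mono finite_bad)
    then show ?thesis
      by (subst (asm) card_image) (auto simp: inj_on_def)
  qed
  have "(\<Sum>m\<in>{0..<M}. \<Sum>j\<in>{0..<J}. real (card {t \<in> {-H..H}. \<not> midpoint 0 (m + t) j})) =
      (\<Sum>z\<in>S. real (card {t \<in> {-H..H}. ?N z t}))"
    unfolding S_def by (simp add: sum.cartesian_product split_def)
  also have "\<dots> = (\<Sum>z\<in>S. \<Sum>t\<in>{-H..H}. of_bool (?N z t))"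
    by (simp only: card_filter_eq_sum finite_atLeastAtMost_int)
  also have "\<dots> = (\<Sum>t\<in>{-H..H}. \<Sum>z\<in>S. of_bool (?N z t))"
    by (rule sum.swap)
  also have "\<dots> = (\<Sum>t\<in>{-H..H}. real (card {z \<in> S. ?N z t}))"
    by (simp only: card_filter_eq_sum S_def finite_cartesian_product finite_atLeastLessThan_int)
  also have "\<dots> \<le> (\<Sum>t\<in>{-H..H}. real (card (bad 0)))"
    using each by (intro sum_mono) simp
  also have "\<dots> = card (bad 0) * real_of_int (2 * H + 1)"
    using pos by simp
  finally show ?thesis .
qed

text \<open>Exceptions in a window are later weighted by 12, and \<open>exists_modal_value\<close>
  turns unequal pairs into exceptions at the rate \<open>2 / 3\<close>; hence the 8. Each column has
  at most \<open>2 * card (bad k)\<close> unequal pairs per pair of offsets on summation, hence the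
  16; the midpoint failures of column 0 add 3 and give the 19.\<close>

lemma exists_base_line:
  fixes \<kappa> :: real
  assumes E0: "35 * int (card (bad 0)) \<le> 3 * (M * J)"
    and E: "16 * card (bad (- 1)) + 19 * card (bad 0) + 16 * card (bad 1) \<le> \<kappa> * (M * J)" and "\<kappa> < 3"
  shows "\<exists>B m j. 8 * real (collisions p (f (- 1)) B H (m - j) + collisions p (f 0) B H m +
        collisions p (f 1) B H (m + j)) / (2 * H + 1) ^ 2 +
      3 * real (card {t \<in> {-H..H}. \<not> midpoint 0 (m + t) j}) / (2 * H + 1) \<le> \<kappa>"
proof -
  have "\<kappa> * (M * J) < 3 * (M * J)"
    using \<open>\<kappa> < 3\<close> pos by simp
  with E have "real_of_int (16 * int (card (bad (- 1)))) < real_of_int (3 * (M * J))"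
      "real_of_int (16 * int (card (bad 1))) < real_of_int (3 * (M * J))"
    by simp_all
  then have E1: "16 * int (card (bad (- 1))) < 3 * (M * J)" "16 * int (card (bad 1)) < 3 * (M * J)"
    by linarith+
  obtain B where B: "\<And>t. t \<in> {0..4 * H} \<Longrightarrow>
      int (card {m \<in> {- 2 * H..<M + 2 * H}. \<not> [f 0 (m + t) - f 0 m = B * t] (mod p)}) * J \<le> 2 * card (bad 0)"
    using column_zero[OF E0] by blast
  define w where "w = real_of_int (2 * H + 1)"
  have w: "w > 0"
    using pos by (simp add: w_def)
  have card_int: "c * card {0..<n} \<le> e" if "int c * n \<le> int e" "n > 0" for c e :: nat and n :: int
  proof -
    have "int (c * card {0..<n}) \<le> int e"
      using that by simp
    then show ?thesis
      by (simp only: of_nat_le_iff)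
  qed
  have "(\<Sum>m\<in>{0..<M}. \<Sum>j\<in>{0..<J}. real (collisions p (f 1) B H (m + 1 * j))) \<le> real (2 * card (bad 1)) * w ^ 2"
    unfolding w_def
  proof (rule sum_collisions_column_le)
    show "card {x \<in> {- 2 * H..<M + J + 2 * H}. \<not> [f 1 (x + t) - f 1 x = B * t] (mod p)} * card {0..<M} \<le> 2 * card (bad 1)"
      if "t \<in> {0..2 * H}" for t
      using column_plus_minus[OF _ E0 E1(2) B that] pos by (intro card_int) auto
  qed (use pos in \<open>auto simp: inj_on_def\<close>)
  moreover have "(\<Sum>m\<in>{0..<M}. \<Sum>j\<in>{0..<J}. real (collisions p (f (- 1)) B H (m - j))) \<le> real (2 * card (bad (- 1))) * w ^ 2"
    unfolding w_def
  proof (rule sum_collisions_column_le)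
    show "card {x \<in> {- J - 2 * H..<M + 2 * H}. \<not> [f (- 1) (x + t) - f (- 1) x = B * t] (mod p)} * card {0..<M} \<le> 2 * card (bad (- 1))"
      if "t \<in> {0..2 * H}" for t
      using column_plus_minus[OF _ E0 E1(1) B that] pos by (intro card_int) auto
  qed (use pos in \<open>auto simp: inj_on_def\<close>)
  moreover have "(\<Sum>m\<in>{0..<M}. \<Sum>j\<in>{0..<J}. real (collisions p (f 0) B H m)) \<le> real (2 * card (bad 0)) * w ^ 2"
  proof -
    have "(\<Sum>j\<in>{0..<J}. \<Sum>m\<in>{0..<M}. real (collisions p (f 0) B H m)) \<le> real (2 * card (bad 0)) * w ^ 2"
      unfolding w_def
    proof (rule sum_collisions_column_le)
      show "card {x \<in> {- 2 * H..<M + 2 * H}. \<not> [f 0 (x + t) - f 0 x = B * t] (mod p)} * card {0..<J} \<le> 2 * card (bad 0)"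
        if "t \<in> {0..2 * H}" for t
        using B[of t] that pos by (intro card_int) auto
    qed (use pos in auto)
    then show ?thesis
      by (subst sum.swap)
  qed
  moreover have "(\<Sum>m\<in>{0..<M}. \<Sum>j\<in>{0..<J}. real (card {t \<in> {-H..H}. \<not> midpoint 0 (m + t) j})) \<le> card (bad 0) * w"
    unfolding w_def by (rule sum_midpoint_failures_le)
  ultimately have "8 / w ^ 2 * (\<Sum>m\<in>{0..<M}. \<Sum>j\<in>{0..<J}. real (collisions p (f (- 1)) B H (m - j))) +
      8 / w ^ 2 * (\<Sum>m\<in>{0..<M}. \<Sum>j\<in>{0..<J}. real (collisions p (f 0) B H m)) +
      8 / w ^ 2 * (\<Sum>m\<in>{0..<M}. \<Sum>j\<in>{0..<J}. real (collisions p (f 1) B H (m + j))) +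
      3 / w * (\<Sum>m\<in>{0..<M}. \<Sum>j\<in>{0..<J}. real (card {t \<in> {-H..H}. \<not> midpoint 0 (m + t) j}))
    \<le> 8 / w ^ 2 * (real (2 * card (bad (- 1))) * w ^ 2) + 8 / w ^ 2 * (real (2 * card (bad 0)) * w ^ 2) +
      8 / w ^ 2 * (real (2 * card (bad 1)) * w ^ 2) + 3 / w * (card (bad 0) * w)"
    using w by (intro add_mono mult_left_mono) (simp_all only: mult_1, simp_all)
  also have "\<dots> = 16 * card (bad (- 1)) + 19 * card (bad 0) + 16 * card (bad 1)"
    using w by simp
  also have "\<dots> \<le> \<kappa> * (M * J)"
    using E .
  finally have "(\<Sum>m\<in>{0..<M}. \<Sum>j\<in>{0..<J}.
        8 / w ^ 2 * real (collisions p (f (- 1)) B H (m - j)) +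
        8 / w ^ 2 * real (collisions p (f 0) B H m) + 8 / w ^ 2 * real (collisions p (f 1) B H (m + j)) +
      3 / w * real (card {t \<in> {-H..H}. \<not> midpoint 0 (m + t) j})) \<le> \<kappa> * (M * J)"
    by (simp only: sum.distrib flip: sum_distrib_left)
  then have "(\<Sum>(m, j)\<in>{0..<M} \<times> {0..<J}.
        8 / w ^ 2 * real (collisions p (f (- 1)) B H (m - j)) +
        8 / w ^ 2 * real (collisions p (f 0) B H m) + 8 / w ^ 2 * real (collisions p (f 1) B H (m + j)) +
      3 / w * real (card {t \<in> {-H..H}. \<not> midpoint 0 (m + t) j})) \<le> \<kappa> * card ({0..<M} \<times> {0..<J})"
    using pos by (simp add: sum.cartesian_product)
  from exists_sum_le_average[OF _ _ this] pos
  obtain m j where "8 / w ^ 2 * real (collisions p (f (- 1)) B H (m - j)) +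
        8 / w ^ 2 * real (collisions p (f 0) B H m) + 8 / w ^ 2 * real (collisions p (f 1) B H (m + j)) +
      3 / w * real (card {t \<in> {-H..H}. \<not> midpoint 0 (m + t) j}) \<le> \<kappa>"
    by auto
  then show ?thesis
    unfolding w_def by (intro exI[of _ B] exI[of _ m] exI[of _ j]) (simp add: add_divide_distrib distrib_left)
qed

lemma exists_window_value:
  assumes "8 * real (collisions p \<phi> B H x) < 3 * real_of_int (2 * H + 1) ^ 2"
  shows "\<exists>v. real (card {t \<in> {-H..H}. \<not> [\<phi> (x + t) = v + B * t] (mod p)}) * (2 * H + 1)
    \<le> 2 / 3 * collisions p \<phi> B H x"
proof -
  have "\<exists>v. real (card {t \<in> {-H..H}. \<not> [\<phi> (x + t) - B * t = v] (mod p)}) * card {-H..H}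
      \<le> 2 / 3 * collisions p \<phi> B H x"
    using assms pos by (intro exists_modal_value) (auto simp: collisions_def)
  moreover have "[\<phi> (x + t) - B * t = v] (mod p) \<longleftrightarrow> [\<phi> (x + t) = v + B * t] (mod p)" for v t
    by (simp add: cong_iff_dvd_diff algebra_simps)
  ultimately show ?thesis
    using pos by simp
qed

text \<open>
  For \<open>\<kappa> < 3\<close>, the exceptional points number less than a quarter of a window. A point at most four
  columns away from each of the three has about a quarter of a window of slopes whose lines meet
  the columns inside their windows, so one of these lines avoids the exceptional points; see
  \<open>good_near_window\<close>.
\<close>

lemma exists_affine_window:
  fixes \<kappa> :: real
  assumes E0: "35 * int (card (bad 0)) \<le> 3 * (M * J)"
    and E: "16 * card (bad (- 1)) + 19 * card (bad 0) + 16 * card (bad 1) \<le> \<kappa> * (M * J)" and "\<kappa> < 3"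
  shows "\<exists>m j v a B. 12 * real (\<Sum>k\<in>{-1, 0, 1}.
    card {t \<in> {-H..H}. \<not> [f k (m + k * j + t) = v + a * k + B * t] (mod p)}) \<le> \<kappa> * (2 * H + 1)"
proof -
  define w where "w = real_of_int (2 * H + 1)"
  have w: "w > 0"
    using pos by (simp add: w_def)
  obtain B m j where "8 * real (collisions p (f (- 1)) B H (m - j) + collisions p (f 0) B H m +
        collisions p (f 1) B H (m + j)) / w ^ 2 +
      3 * real (card {t \<in> {-H..H}. \<not> midpoint 0 (m + t) j}) / w \<le> \<kappa>"
    using exists_base_line[OF assms] unfolding w_def by auto
  moreover define C where "C k = real (collisions p (f k) B H (m + k * j))" for k
  moreover define s where "s = real (card {t \<in> {-H..H}. \<not> midpoint 0 (m + t) j})"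
  ultimately have "8 * (C (- 1) + C 0 + C 1) / w ^ 2 + 3 * s / w \<le> \<kappa>"
    by simp
  then have prod: "(8 * (C (- 1) + C 0 + C 1) / w ^ 2 + 3 * s / w) * w ^ 2 \<le> \<kappa> * w ^ 2"
    by (rule mult_right_mono) simp
  have "(8 * X / w ^ 2 + 3 * s / w) * w ^ 2 = 8 * X + 3 * (s * w)" for X
    using w by (simp add: field_simps power2_eq_square)
  from this[of "C (- 1) + C 0 + C 1"] prod have total: "8 * (C (- 1) + C 0 + C 1) + 3 * (s * w) \<le> \<kappa> * w * w"
    by (simp only: power2_eq_square mult.assoc)
  have \<kappa>: "\<kappa> * w * w < 3 * w * w"
    using w \<open>\<kappa> < 3\<close> by simp
  have nonneg: "C k \<ge> 0" "s * w \<ge> 0" for k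
    using w by (simp_all add: C_def s_def)
  have "\<exists>v. real (card {t \<in> {-H..H}. \<not> [f k (m + k * j + t) = v + B * t] (mod p)}) * w \<le> 2 / 3 * C k"
    if "k \<in> {-1, 0, 1}" for k
    unfolding C_def w_def
  proof (rule exists_window_value)
    have "8 * C k \<le> \<kappa> * w * w"
      using that total nonneg(1)[of "-1"] nonneg(1)[of 0] nonneg(1)[of 1] nonneg(2) by auto
    with \<kappa> have "8 * C k < 3 * w ^ 2"
      unfolding power2_eq_square by linarith
    then show "8 * real (collisions p (f k) B H (m + k * j)) < 3 * real_of_int (2 * H + 1) ^ 2"
      by (simp only: C_def w_def)
  qed
  then have "\<forall>k. \<exists>v. k \<in> {-1, 0, 1} \<longrightarrow>
      real (card {t \<in> {-H..H}. \<not> [f k (m + k * j + t) = v + B * t] (mod p)}) * w \<le> 2 / 3 * C k"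
    by blast
  from choice[OF this] obtain v where v: "\<forall>k. k \<in> {-1, 0, 1} \<longrightarrow>
      real (card {t \<in> {-H..H}. \<not> [f k (m + k * j + t) = v k + B * t] (mod p)}) * w \<le> 2 / 3 * C k" ..
  define N where "N k = {t \<in> {-H..H}. \<not> [f k (m + k * j + t) = v k + B * t] (mod p)}" for k
  define S where "S = {t \<in> {-H..H}. \<not> midpoint 0 (m + t) j}"
  have N: "real (card (N k)) * w \<le> 2 / 3 * C k" if "k \<in> {-1, 0, 1}" for k
    unfolding N_def using v that by blast
  have "12 * ((card (N (- 1)) + card (N 0) + card (N 1)) * w) + 3 * (s * w) \<le> \<kappa> * w * w"
    using N[of "-1"] N[of 0] N[of 1] total by (simp add: algebra_simps)
  then have "(12 * (card (N (- 1)) + card (N 0) + card (N 1)) + 3 * s) * w \<le> (\<kappa> * w) * w"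
    by (simp add: algebra_simps)
  then have count: "12 * (card (N (- 1)) + card (N 0) + card (N 1)) + 3 * s \<le> \<kappa> * w"
    using w by simp
  have fin: "finite (N k)" "finite S" for k
    by (rule finite_subset[of _ "{-H..H}"], auto simp: N_def S_def)+
  \<comment> \<open>One offset \<open>t\<close> at which all three columns take their frequent
    values and the midpoint relation holds suffices to put \<open>v (- 1)\<close>,
    \<open>v 0\<close>, \<open>v 1\<close> in arithmetic progression. The weight 3 of
    \<open>s\<close> makes the total less than \<open>w\<close> for
    \<open>\<kappa> < 3\<close>.\<close>
  have "\<not> {-H..H} \<subseteq> N (- 1) \<union> N 0 \<union> N 1 \<union> S"
  proof
    assume "{-H..H} \<subseteq> N (- 1) \<union> N 0 \<union> N 1 \<union> S"
    then have "card {-H..H} \<le> card (N (- 1) \<union> N 0 \<union> N 1 \<union> S)"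
      using fin by (intro card_mono) auto
    also have "\<dots> \<le> card (N (- 1)) + card (N 0) + card (N 1) + card S"
      using card_Un_le[of "N (- 1) \<union> N 0 \<union> N 1" S] card_Un_le[of "N (- 1) \<union> N 0" "N 1"]
        card_Un_le[of "N (- 1)" "N 0"] by linarith
    finally have "real (card {-H..H}) \<le> card (N (- 1)) + card (N 0) + card (N 1) + s"
      by (simp add: s_def S_def)
    moreover have "real (card {-H..H}) = w"
      using pos by (simp add: w_def)
    moreover have "\<kappa> * w < 3 * w"
      using w \<open>\<kappa> < 3\<close> by simp
    ultimately show False
      using count by simp
  qed
  then obtain t where t: "t \<in> {-H..H}" "t \<notin> N (- 1)" "t \<notin> N 0" "t \<notin> N 1" "t \<notin> S"
    by blast
  have fv: "[f (- 1) (m - j + t) = v (- 1) + B * t] (mod p)" "[f 0 (m + t) = v 0 + B * t] (mod p)"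
    "[f 1 (m + j + t) = v 1 + B * t] (mod p)"
    using t by (auto simp: N_def)
  have "[f (- 1) (m - j + t) + f 1 (m + j + t) = 2 * f 0 (m + t)] (mod p)"
    using t by (auto simp: S_def midpoint_def algebra_simps)
  then have "[(v (- 1) + B * t) + (v 1 + B * t) = 2 * (v 0 + B * t)] (mod p)"
    using cong_add[OF fv(1) fv(3)] cong_scalar_left[OF fv(2), of 2] by (meson cong_sym cong_trans)
  then have "p dvd v (- 1) + v 1 - 2 * v 0"
    by (simp add: cong_iff_dvd_diff algebra_simps)
  then have vv: "[v (- 1) = v 0 - (v 1 - v 0)] (mod p)"
    by (simp add: cong_iff_dvd_diff algebra_simps)
  have "{t \<in> {-H..H}. \<not> [f k (m + k * j + t) = v 0 + (v 1 - v 0) * k + B * t] (mod p)} = N k"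
    if "k \<in> {-1, 0, 1}" for k
  proof -
    have "[v 0 + (v 1 - v 0) * k + B * t = v k + B * t] (mod p)" for t
      using that vv cong_sym by (intro cong_add) auto
    then show ?thesis
      unfolding N_def cong_def by simp
  qed
  then have eq: "(\<Sum>k\<in>{-1, 0, 1}. card {t \<in> {-H..H}. \<not> [f k (m + k * j + t) = v 0 + (v 1 - v 0) * k + B * t] (mod p)})
     = (\<Sum>k\<in>{-1, 0, 1}. card (N k))"
    by (intro sum.cong[OF refl] arg_cong[where f = card])
  have "12 * real (\<Sum>k\<in>{-1, 0, 1}. card (N k)) \<le> \<kappa> * w"
    using count by (simp add: s_def)
  then have "12 * real (\<Sum>k\<in>{-1, 0, 1}. card {t \<in> {-H..H}.
      \<not> [f k (m + k * j + t) = v 0 + (v 1 - v 0) * k + B * t] (mod p)}) \<le> \<kappa> * (2 * H + 1)"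
    unfolding eq w_def .
  then show ?thesis
    by blast
qed

end

section \<open>Affine forms modulo p\<close>

text \<open>This is the part of the rule about valuation zero, on which the determination of
  \<open>F\<close> modulo \<open>p\<close> off the zeros rests. It is stable under shears.\<close>

definition affine_lines :: "int \<Rightarrow> int \<Rightarrow> (int \<Rightarrow> int \<Rightarrow> int) \<Rightarrow> bool" where
  "affine_lines p N F \<longleftrightarrow> (\<forall>j i. \<exists>a b. \<not> (p dvd a \<and> p dvd b) \<and>
     (\<forall>n\<in>{0..<N}. \<not> p dvd a * n + b \<longrightarrow> [F n (j * n + i) = a * n + b] (mod p)))"

lemma prime_dvd_affine_imp:
  fixes p :: int
  assumes "prime p" "p dvd a * x + b" "p dvd a * y + b" "\<not> p dvd x - y"
  shows "p dvd a \<and> p dvd b"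
proof -
  have "p dvd (a * x + b) - (a * y + b)"
    using assms by (intro dvd_diff)
  then have "p dvd a * (x - y)"
    by (simp add: algebra_simps)
  then have "p dvd a"
    using assms by (simp add: prime_dvd_mult_iff)
  moreover from this have "p dvd b"
    using assms(2) by (simp add: dvd_add_right_iff)
  ultimately show ?thesis ..
qed

lemma dvd_diff_imp_eq:
  fixes p x y :: int
  assumes "p dvd x - y" "\<bar>x - y\<bar> < p"
  shows "x = y"
  using zdvd_imp_le[of p "\<bar>x - y\<bar>"] assms by (cases "x = y") auto

text \<open>
  A line is singular in at most one residue class of columns modulo \<open>p\<close>. A failure of the midpoint
  relation in one of the columns \<open>c - 1\<close>, \<open>c\<close>, \<open>c + 1\<close> needs a singularity in this column or a
  neighbour, so the weights 16, 19, 16 of the failures amount to weights 16, 35, 51, 35, 16 of the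
  singularities in the columns \<open>c - 2, \<dots>, c + 2\<close>. Their sum 153 is less than \<open>3 p\<close>: this is
  where \<open>p \<ge> 53\<close> is needed.
\<close>

lemma exists_sparse_box:
  fixes p N H :: int and F :: "int \<Rightarrow> int \<Rightarrow> int"
  assumes p: "prime p" "p \<ge> 53" and N: "N \<ge> p + 9" and F: "affine_lines p N F" and H: "H > 0"
    and M: "M = 10000 * H" and J: "J = 10000 * M"
  shows "\<exists>c\<in>{5..p + 4}. \<exists>r. let bad = sampled_box.bad p H M J (\<lambda>k m. F (c + k) (r + m)) in
    35 * int (card (bad 0)) \<le> 3 * (M * J) \<and>
    16 * card (bad (- 1)) + 19 * card (bad 0) + 16 * card (bad 1) \<le> (293 / 100 :: real) * (M * J)"
proof -
  have "\<forall>z. \<exists>ab. \<not> (p dvd fst ab \<and> p dvd snd ab) \<and> (\<forall>n\<in>{0..<N}. \<not> p dvd fst ab * n + snd ab \<longrightarrow>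
      [F n (fst z * n + snd z) = fst ab * n + snd ab] (mod p))"
    using F unfolding affine_lines_def by (auto simp: split_paired_All)
  from choice[OF this] obtain g where
    g0: "\<not> (p dvd fst (g z) \<and> p dvd snd (g z))" and
    g: "n \<in> {0..<N} \<Longrightarrow> \<not> p dvd fst (g z) * n + snd (g z) \<Longrightarrow>
      [F n (fst z * n + snd z) = fst (g z) * n + snd (g z)] (mod p)" for n z
    by blast
  define sing :: "int \<times> int \<Rightarrow> int \<Rightarrow> bool" where "sing z n \<longleftrightarrow> p dvd fst (g z) * n + snd (g z)" for z n
  define wt :: "int \<times> int \<Rightarrow> int \<Rightarrow> real" where
    "wt z c = 16 * of_bool (sing z (c + (- 2))) + 35 * of_bool (sing z (c + (- 1))) + 51 * of_bool (sing z (c + 0)) +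
      35 * of_bool (sing z (c + 1)) + 16 * of_bool (sing z (c + 2))" for z c
  have wt0: "wt z c \<ge> 0" for z c
    by (simp add: wt_def)
  \<comment> \<open>The range of \<open>c\<close> consists of \<open>p\<close> consecutive columns.
    It starts at 5 so that the nine columns \<open>c - 4, \<dots>, c + 4\<close> needed later lie on
    the board, which \<open>N \<ge> p + 9\<close> permits.\<close>
  have one: "(\<Sum>c\<in>{5..p + 4}. of_bool (sing z (c + d)) :: real) \<le> 1" for z d
  proof -
    have "c = c'" if c: "c \<in> {5..p + 4}" "c' \<in> {5..p + 4}" "sing z (c + d)" "sing z (c' + d)" for c c'
    proof (rule dvd_diff_imp_eq[of p])
      show "p dvd c - c'"
        using prime_dvd_affine_imp[of p "fst (g z)" "c + d" "snd (g z)" "c' + d"] c g0[of z] p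
        by (auto simp: sing_def)
      show "\<bar>c - c'\<bar> < p"
        using c by auto
    qed
    moreover have "finite {c \<in> {5..p + 4}. sing z (c + d)}"
      by (rule finite_subset[of _ "{5..p + 4}"]) auto
    ultimately have "card {c \<in> {5..p + 4}. sing z (c + d)} \<le> 1"
      unfolding One_nat_def by (subst card_le_Suc0_iff_eq) blast+
    moreover have "real (card {c \<in> {5..p + 4}. sing z (c + d)}) = (\<Sum>c\<in>{5..p + 4}. of_bool (sing z (c + d)))"
      by (rule card_filter_eq_sum) simp
    ultimately show ?thesis
      by linarith
  qed
  have wt_sum: "(\<Sum>c\<in>{5..p + 4}. wt z c) \<le> 153" for z
  proof -
    have "(\<Sum>c\<in>{5..p + 4}. wt z c) = 16 * (\<Sum>c\<in>{5..p + 4}. of_bool (sing z (c + (- 2)))) +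
        35 * (\<Sum>c\<in>{5..p + 4}. of_bool (sing z (c + (- 1)))) +
        51 * (\<Sum>c\<in>{5..p + 4}. of_bool (sing z (c + 0))) +
        35 * (\<Sum>c\<in>{5..p + 4}. of_bool (sing z (c + 1))) +
        16 * (\<Sum>c\<in>{5..p + 4}. of_bool (sing z (c + 2)))"
      unfolding wt_def by (simp only: sum.distrib sum_distrib_left)
    also have "\<dots> \<le> 16 * 1 + 35 * 1 + 51 * 1 + 35 * 1 + 16 * 1"
      by (intro add_mono mult_left_mono one) auto
    finally show ?thesis by simp
  qed
  have pos: "M > 0" "J > 0"
    using H M J by auto
  interpret sb: sampled_box p H M J "\<lambda>k m. F (c + k) (r + m)" for c r
    using p pos H primes_dvd_imp_eq[of 2 p] by unfold_locales auto
  define Q where "Q = sampled_box.box H M J"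
  have Q: "Q = {- 6 * H..<M + 6 * H} \<times> {- (M + 10 * H)..<J + M + 10 * H}"
    unfolding Q_def by (rule sb.box_def)
  define L where "L = (M + 6 * H) + (p + 4) * (J + M + 10 * H)"
  \<comment> \<open>\<open>L\<close> bounds the difference between \<open>r\<close> and the
    intercept of a line. The intercepts therefore lie in \<open>{-L..<R + L}\<close>, and this
    enlargement costs only the factor 1.001.\<close>
  define R where "R = 2000 * L"
  have "(p + 4) * (J + M + 10 * H) > 0"
    using p pos H by (intro mult_pos_pos) auto
  then have L: "L > 0"
    using pos H by (simp add: L_def)
  \<comment> \<open>Slope and intercept in column 0 of the board of the line that has height
    \<open>r + fst q\<close> in column \<open>c\<close>. For fixed \<open>c\<close> and
    \<open>q\<close> it is injective in \<open>r\<close>, so each line is charged at most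
    once.\<close>
  define z where "z c r q = (snd q, r + fst q - c * snd q)" for c r :: int and q :: "int \<times> int"
  define \<Phi> where "\<Phi> c r = (\<Sum>q\<in>Q. wt (z c r q) c)" for c r
  have finQ: "finite Q"
    by (simp add: Q)
  have cardQ: "real (card Q) \<le> 1005 / 1000 * (M * J)"
  proof -
    have "card Q = (M + 12 * H) * (J + 2 * M + 20 * H)"
      using pos H by (simp add: Q card_cartesian_product ac_simps)
    moreover have "1000 * ((M + 12 * H) * (J + 2 * M + 20 * H)) \<le> 1005 * (M * J)"
      using H by (simp add: M J algebra_simps)
    ultimately have "1000 * int (card Q) \<le> 1005 * (M * J)"
      by linarith
    then have "real_of_int (1000 * int (card Q)) \<le> real_of_int (1005 * (M * J))"
      by (simp only: of_int_le_iff)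
    then show ?thesis by (simp add: ac_simps)
  qed
  have bad_sing: "sing (z c r q) (c + (k - 1)) \<or> sing (z c r q) (c + k) \<or> sing (z c r q) (c + (k + 1))"
    if "c \<in> {5..p + 4}" "k \<in> {-1, 0, 1}" "\<not> sb.midpoint c r k (fst q) (snd q)" for c r k q
  proof (rule ccontr)
    let ?a = "fst (g (z c r q))" and ?b = "snd (g (z c r q))"
    have val: "[F (c + l) (r + (fst q + l * snd q)) = ?a * (c + l) + ?b] (mod p)"
      if "\<not> sing (z c r q) (c + l)" "c + l \<in> {0..<N}" for l
      using g[OF that(2), of "z c r q"] that(1) by (simp add: sing_def z_def algebra_simps)
    assume "\<not> ?thesis"
    then have "[F (c + (k - 1)) (r + (fst q + (k - 1) * snd q)) = ?a * (c + (k - 1)) + ?b] (mod p)"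
      "[F (c + k) (r + (fst q + k * snd q)) = ?a * (c + k) + ?b] (mod p)"
      "[F (c + (k + 1)) (r + (fst q + (k + 1) * snd q)) = ?a * (c + (k + 1)) + ?b] (mod p)"
      using that(1,2) N by (auto intro!: val)
    note v = this
    note cong_add[OF v(1) v(3)] cong_scalar_left[OF v(2), of 2]
    moreover have "(?a * (c + (k - 1)) + ?b) + (?a * (c + (k + 1)) + ?b) = 2 * (?a * (c + k) + ?b)"
      by (simp add: algebra_simps)
    ultimately have "sb.midpoint c r k (fst q) (snd q)"
      unfolding sb.midpoint_def cong_def by simp
    then show False
      using that(3) by contradiction
  qed
  have card_bad: "real (card (sb.bad c r k)) = (\<Sum>q\<in>Q. of_bool (\<not> sb.midpoint c r k (fst q) (snd q)))" for c r k
  proof -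
    have "sb.bad c r k = {q \<in> Q. \<not> sb.midpoint c r k (fst q) (snd q)}"
      by (auto simp: sb.bad_def Q_def)
    then show ?thesis
      by (simp only: card_filter_eq_sum[OF finQ])
  qed
  \<comment> \<open>A failure in the middle needs a singularity in one of the three central columns,
    all of which have weight at least 35.\<close>
  have le1: "35 * real (card (sb.bad c r 0)) \<le> \<Phi> c r" if "c \<in> {5..p + 4}" for c r
    unfolding card_bad \<Phi>_def sum_distrib_left
    using bad_sing[OF that, of 0 r] by (intro sum_mono) (force simp: wt_def)
  have le2: "16 * real (card (sb.bad c r (- 1))) + 19 * real (card (sb.bad c r 0)) + 16 * real (card (sb.bad c r 1)) \<le> \<Phi> c r"
    if "c \<in> {5..p + 4}" for c r
    unfolding card_bad \<Phi>_def sum_distrib_left sum.distrib[symmetric]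
  proof (rule sum_mono)
    fix q assume "q \<in> Q"
    let ?s = "\<lambda>d. of_bool (sing (z c r q) (c + d)) :: real" and ?b = "\<lambda>k. of_bool (\<not> sb.midpoint c r k (fst q) (snd q)) :: real"
    have "?b (- 1) \<le> ?s (- 2) + ?s (- 1) + ?s 0"
      using bad_sing[OF that, of "- 1" r q] by auto
    moreover have "?b 0 \<le> ?s (- 1) + ?s 0 + ?s 1"
      using bad_sing[OF that, of 0 r q] by auto
    moreover have "?b 1 \<le> ?s 0 + ?s 1 + ?s 2"
      using bad_sing[OF that, of 1 r q] by auto
    ultimately show "16 * ?b (- 1) + 19 * ?b 0 + 16 * ?b 1 \<le> wt (z c r q) c"
      unfolding wt_def by linarith
  qed
  have "(\<Sum>(c, r)\<in>{5..p + 4} \<times> {0..<R}. \<Phi> c r) \<le> 153 * real_of_int (R + 2 * L) * card Q"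
  proof -
    have "(\<Sum>(c, r)\<in>{5..p + 4} \<times> {0..<R}. \<Phi> c r) = (\<Sum>c\<in>{5..p + 4}. \<Sum>r\<in>{0..<R}. \<Phi> c r)"
      by (simp add: sum.cartesian_product)
    also have "\<dots> = (\<Sum>q\<in>Q. \<Sum>c\<in>{5..p + 4}. \<Sum>r\<in>{0..<R}. wt (z c r q) c)"
      unfolding \<Phi>_def by (subst sum.swap[of _ Q], subst sum.swap[of _ Q]) (rule refl)
    also have "\<dots> \<le> (\<Sum>q\<in>Q. 153 * real_of_int (R + 2 * L))"
    proof (rule sum_mono)
      fix q assume q: "q \<in> Q"
      have "(\<Sum>r\<in>{0..<R}. wt (z c r q) c) \<le> (\<Sum>i\<in>{-L..<R + L}. wt (snd q, i) c)"
        if c: "c \<in> {5..p + 4}" for c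
      proof -
        have "(\<Sum>r\<in>{0..<R}. wt (z c r q) c) =
            (\<Sum>i\<in>(\<lambda>r. r + fst q - c * snd q) ` {0..<R}. wt (snd q, i) c)"
          by (subst sum.reindex) (auto simp: inj_on_def z_def)
        also have "\<dots> \<le> (\<Sum>i\<in>{-L..<R + L}. wt (snd q, i) c)"
        proof (rule sum_mono2)
          have "\<bar>c * snd q\<bar> \<le> (p + 4) * (J + M + 10 * H)"
            unfolding abs_mult using c q pos H by (intro mult_mono) (auto simp: Q)
          moreover have "\<bar>fst q\<bar> \<le> M + 6 * H"
            using q pos H by (auto simp: Q)
          ultimately show "(\<lambda>r. r + fst q - c * snd q) ` {0..<R} \<subseteq> {-L..<R + L}"
            by (auto simp: L_def)
        qed (auto simp: wt0)
        finally show ?thesis .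
      qed
      then have "(\<Sum>c\<in>{5..p + 4}. \<Sum>r\<in>{0..<R}. wt (z c r q) c) \<le>
          (\<Sum>c\<in>{5..p + 4}. \<Sum>i\<in>{-L..<R + L}. wt (snd q, i) c)"
        by (rule sum_mono)
      also have "\<dots> = (\<Sum>i\<in>{-L..<R + L}. \<Sum>c\<in>{5..p + 4}. wt (snd q, i) c)"
        by (rule sum.swap)
      also have "\<dots> \<le> (\<Sum>i\<in>{-L..<R + L}. 153)"
        by (intro sum_mono wt_sum)
      also have "\<dots> = 153 * real_of_int (R + 2 * L)"
        using L by (simp add: R_def)
      finally show "(\<Sum>c\<in>{5..p + 4}. \<Sum>r\<in>{0..<R}. wt (z c r q) c) \<le> 153 * real_of_int (R + 2 * L)"
        by simp
    qed
    also have "\<dots> = 153 * real_of_int (R + 2 * L) * card Q"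
      by simp
    finally show ?thesis .
  qed
  also have "\<dots> \<le> 153 * real_of_int (R + 2 * L) * (1005 / 1000 * (M * J))"
    using cardQ L by (intro mult_left_mono) (auto simp: R_def)
  \<comment> \<open>The factors 1.001 and 1.005 are the losses from the intercepts and from the
    margins of the box. The product is below 154, and \<open>154 / 53\<close> is below 2.93.\<close>
  also have "\<dots> = (153 * 1001 * 1005 / 10 ^ 6 * (M * J)) * R"
    by (simp add: R_def)
  also have "\<dots> \<le> (293 / 100 * 53 * (M * J)) * R"
    using L pos by (intro mult_right_mono) (auto simp: R_def)
  also have "\<dots> \<le> (293 / 100 * p * (M * J)) * R"
    using L pos p by (intro mult_right_mono mult_left_mono) (auto simp: R_def)
  also have "\<dots> = (293 / 100 * (M * J)) * card ({5..p + 4} \<times> {0..<R})"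
    using p L by (simp add: card_cartesian_product R_def)
  finally have avg: "(\<Sum>(c, r)\<in>{5..p + 4} \<times> {0..<R}. \<Phi> c r) \<le> (293 / 100 * (M * J)) * card ({5..p + 4} \<times> {0..<R})" .
  have "\<exists>x\<in>{5..p + 4} \<times> {0..<R}. (case x of (c, r) \<Rightarrow> \<Phi> c r) \<le> 293 / 100 * (M * J)"
    by (rule exists_sum_le_average[OF _ _ avg]) (use p L in \<open>auto simp: R_def\<close>)
  then obtain c r where cr: "c \<in> {5..p + 4}" "\<Phi> c r \<le> 293 / 100 * (M * J)"
    by force
  have "(0 :: real) < real_of_int (M * J)"
    using pos by simp
  then have "real_of_int (35 * int (card (sb.bad c r 0))) \<le> real_of_int (3 * (M * J))"
    using le1[OF cr(1), of r] cr(2) by simp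
  then have "35 * int (card (sb.bad c r 0)) \<le> 3 * (M * J)"
    by (simp only: of_int_le_iff)
  then show ?thesis
    using le2[OF cr(1), of r] cr by (intro bexI[of _ c] exI[of _ r]) (auto simp: Let_def)
qed

section \<open>Spreading an affine form from a window to the board\<close>

locale affine_lines_array =
  fixes p N :: int and F :: "int \<Rightarrow> int \<Rightarrow> int"
  assumes p: "prime p" "p \<ge> 53" and N: "N \<ge> p + 9" and lines: "affine_lines p N F"
    and nonzero: "n \<in> {0..<N} \<Longrightarrow> \<not> p dvd F n m"
begin

text \<open>At a zero of the form agreement is impossible, since \<open>F\<close> has no value
  divisible by \<open>p\<close>; zeros are therefore accepted unconditionally.\<close>

definition good :: "int \<Rightarrow> int \<Rightarrow> int \<Rightarrow> int \<Rightarrow> int \<Rightarrow> bool" where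
  "good \<alpha> \<beta> \<gamma> n m \<longleftrightarrow> [F n m = \<alpha> * n + \<beta> * m + \<gamma>] (mod p) \<or> p dvd \<alpha> * n + \<beta> * m + \<gamma>"

text \<open>At most one of three incongruent columns is singular for the line of slope
  \<open>s\<close> through \<open>(n, m)\<close>. In the other two its own \<open>a u + b\<close>
  agrees with the form, and two incongruent agreements identify the affine functions modulo
  \<open>p\<close>.\<close>

lemma good_if_three_columns:
  assumes n: "n \<in> {0..<N}" and xyz: "{x, y, z} \<subseteq> {0..<N}"
    and incong: "\<not> p dvd x - y" "\<not> p dvd x - z" "\<not> p dvd y - z"
    and F: "\<And>u. u \<in> {x, y, z} \<Longrightarrow> [F u (m + s * (u - n)) = \<alpha> * u + \<beta> * (m + s * (u - n)) + \<gamma>] (mod p)"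
  shows "good \<alpha> \<beta> \<gamma> n m"
proof -
  obtain a b where ab: "\<not> (p dvd a \<and> p dvd b)"
    and g: "\<And>u. u \<in> {0..<N} \<Longrightarrow> \<not> p dvd a * u + b \<Longrightarrow> [F u (s * u + (m - s * n)) = a * u + b] (mod p)"
    using lines unfolding affine_lines_def by blast
  define a' b' where "a' = \<alpha> + \<beta> * s" and "b' = \<beta> * (m - s * n) + \<gamma>"
  have agree: "p dvd (a - a') * u + (b - b')" if "u \<in> {x, y, z}" "\<not> p dvd a * u + b" for u
  proof -
    have "[F u (m + s * (u - n)) = a * u + b] (mod p)"
      using g[of u] that xyz by (auto simp: algebra_simps)
    then have "[a * u + b = \<alpha> * u + \<beta> * (m + s * (u - n)) + \<gamma>] (mod p)"
      using F[OF that(1)] unfolding cong_def by simp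
    then show ?thesis
      by (simp add: cong_iff_dvd_diff a'_def b'_def algebra_simps)
  qed
  have pair: "p dvd a - a' \<and> p dvd b - b'"
    if "u \<in> {x, y, z}" "v \<in> {x, y, z}" "\<not> p dvd u - v" "\<not> p dvd a * u + b" "\<not> p dvd a * v + b" for u v
    using prime_dvd_affine_imp[OF p(1) agree[of u] agree[of v]] that by blast
  have "p dvd a - a' \<and> p dvd b - b'"
  proof (cases "p dvd a * x + b")
    case True
    then have "\<not> p dvd a * y + b" "\<not> p dvd a * z + b"
      using prime_dvd_affine_imp[OF p(1)] ab incong by blast+
    then show ?thesis
      using pair[of y z] incong by blast
  next
    case False
    show ?thesis
    proof (cases "p dvd a * y + b")
      case True
      then have "\<not> p dvd a * z + b"
        using prime_dvd_affine_imp[OF p(1)] ab incong by blast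
      then show ?thesis
        using pair[of x z] incong False by blast
    next
      case no: False
      then show ?thesis
        using pair[of x y] incong False by blast
    qed
  qed
  then have "p dvd (a - a') * n + (b - b')"
    by (intro dvd_add dvd_mult2) auto
  then have h: "[a * n + b = \<alpha> * n + \<beta> * m + \<gamma>] (mod p)"
    by (simp add: cong_iff_dvd_diff a'_def b'_def algebra_simps)
  show ?thesis
  proof (cases "p dvd \<alpha> * n + \<beta> * m + \<gamma>")
    case True
    then show ?thesis by (simp add: good_def)
  next
    case False
    then have "\<not> p dvd a * n + b"
      using h by (simp add: cong_dvd_iff)
    then have "[F n m = a * n + b] (mod p)"
      using g[OF n] by simp
    then show ?thesis
      using h unfolding good_def cong_def by simp
  qed
qed

text \<open>A good cell gives a value only off the zeros, so a line with few zeros in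
  \<open>K\<close> is needed. If \<open>p\<close> divides \<open>\<beta>\<close>, the zeros fill
  whole columns, at most one of them in \<open>K\<close>. Otherwise each of the four columns has a
  zero for at most one of the four slopes, so some slope has at most one zero.\<close>

lemma exists_slope_few_zeros:
  assumes "\<not> (p dvd \<alpha> \<and> p dvd \<beta> \<and> p dvd \<gamma>)" and K: "finite K" "card K = 4"
    and incong: "\<And>x y. x \<in> insert n K \<Longrightarrow> y \<in> insert n K \<Longrightarrow> p dvd x - y \<Longrightarrow> x = y" and "n \<notin> K"
    and \<sigma>: "\<sigma> \<in> {-1, 1}"
  shows "\<exists>s\<in>{1..4}. card {u \<in> K. p dvd \<alpha> * u + \<beta> * (m + \<sigma> * s * (u - n)) + \<gamma>} \<le> 1"
proof (cases "p dvd \<beta>")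
  case True
  have "{u \<in> K. p dvd \<alpha> * u + \<beta> * (m + \<sigma> * 1 * (u - n)) + \<gamma>} = {u \<in> K. p dvd \<alpha> * u + \<gamma>}"
    using True by (auto simp: dvd_add_left_iff dvd_add_right_iff)
      (metis dvd_add_left_iff dvd_mult2 add.commute add.assoc)+
  moreover have "card {u \<in> K. p dvd \<alpha> * u + \<gamma>} \<le> 1"
  proof -
    have "finite {u \<in> K. p dvd \<alpha> * u + \<gamma>}"
      using K by simp
    moreover have "x = y" if "x \<in> {u \<in> K. p dvd \<alpha> * u + \<gamma>}" "y \<in> {u \<in> K. p dvd \<alpha> * u + \<gamma>}" for x y
      using that prime_dvd_affine_imp[OF p(1), of \<alpha> x \<gamma> y] assms(1) True incong by blast
    ultimately show ?thesis
      unfolding One_nat_def by (subst card_le_Suc0_iff_eq) blast+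
  qed
  ultimately show ?thesis
    by (intro bexI[of _ 1]) auto
next
  case False
  let ?Z = "\<lambda>s u. p dvd \<alpha> * u + \<beta> * (m + \<sigma> * s * (u - n)) + \<gamma>"
  have each: "card {s \<in> {1..4}. ?Z s u} \<le> 1" if "u \<in> K" for u
  proof -
    have "s = s'" if "s \<in> {1..4}" "s' \<in> {1..4}" "?Z s u" "?Z s' u" for s s'
    proof -
      have "p dvd (\<alpha> * u + \<beta> * (m + \<sigma> * s * (u - n)) + \<gamma>) - (\<alpha> * u + \<beta> * (m + \<sigma> * s' * (u - n)) + \<gamma>)"
        using that by (intro dvd_diff)
      then have "p dvd \<beta> * (\<sigma> * ((s - s') * (u - n)))"
        by (simp add: algebra_simps)
      moreover have "\<not> p dvd u - n"
        using incong[of u n] \<open>u \<in> K\<close> \<open>n \<notin> K\<close> by auto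
      ultimately have "p dvd s - s'"
        using False \<sigma> p(1) by (auto simp: prime_dvd_mult_iff)
      then show ?thesis
        using that p(2) by (intro dvd_diff_imp_eq[of p]) auto
    qed
    moreover have "finite {s \<in> {1..4}. ?Z s u}"
      by (rule finite_subset[of _ "{1..4}"]) auto
    ultimately show ?thesis
      unfolding One_nat_def by (subst card_le_Suc0_iff_eq) blast+
  qed
  have "(\<Sum>s\<in>{1..4}. real (card {u \<in> K. ?Z s u})) = (\<Sum>s\<in>{1..4}. \<Sum>u\<in>K. of_bool (?Z s u))"
    by (simp only: card_filter_eq_sum[OF K(1)])
  also have "\<dots> = (\<Sum>u\<in>K. \<Sum>s\<in>{1..4}. of_bool (?Z s u))"
    by (rule sum.swap)
  also have "\<dots> = (\<Sum>u\<in>K. real (card {s \<in> {1..4}. ?Z s u}))"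
    by (simp only: card_filter_eq_sum finite_atLeastAtMost_int)
  also have "\<dots> \<le> (\<Sum>u\<in>K. 1)"
    using each by (intro sum_mono) (simp only: of_nat_le_1_iff)
  also have "\<dots> = 1 * real (card {1..4 :: int})"
    using K by simp
  finally have "(\<Sum>s\<in>{1..4}. real (card {u \<in> K. ?Z s u})) \<le> 1 * real (card {1..4 :: int})" .
  then have "\<exists>s\<in>{1..4}. real (card {u \<in> K. ?Z s u}) \<le> 1"
    by (intro exists_sum_le_average) auto
  then show ?thesis
    by (simp only: of_nat_le_1_iff)
qed

text \<open>One column is sacrificed to a zero; the other three feed
  \<open>good_if_three_columns\<close>. The sign \<open>\<sigma>\<close> lets the lines be steered
  towards known cells.\<close>

lemma good_if_four_columns:
  assumes nz: "\<not> (p dvd \<alpha> \<and> p dvd \<beta> \<and> p dvd \<gamma>)" and K: "K \<subseteq> {0..<N}" "card K = 4" and n: "n \<in> {0..<N}"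
    and incong: "\<And>x y. x \<in> insert n K \<Longrightarrow> y \<in> insert n K \<Longrightarrow> p dvd x - y \<Longrightarrow> x = y" and "n \<notin> K"
    and \<sigma>: "\<sigma> \<in> {-1, 1}"
    and good: "\<And>u s. u \<in> K \<Longrightarrow> s \<in> {1..4} \<Longrightarrow> good \<alpha> \<beta> \<gamma> u (m + \<sigma> * s * (u - n))"
  shows "good \<alpha> \<beta> \<gamma> n m"
proof -
  have fin: "finite K"
    using K by (intro finite_subset[OF K(1)]) auto
  obtain s where s: "s \<in> {1..4}" "card {u \<in> K. p dvd \<alpha> * u + \<beta> * (m + \<sigma> * s * (u - n)) + \<gamma>} \<le> 1"
    using exists_slope_few_zeros[OF nz fin K(2) incong \<open>n \<notin> K\<close> \<sigma>] by blast
  let ?Z = "{u \<in> K. p dvd \<alpha> * u + \<beta> * (m + \<sigma> * s * (u - n)) + \<gamma>}"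
  have "card (K - ?Z) = card K - card ?Z"
    using fin by (intro card_Diff_subset) auto
  then have "3 \<le> card (K - ?Z)"
    using s(2) K(2) by linarith
  then obtain L where L: "L \<subseteq> K - ?Z" "card L = 3"
    by (meson obtain_subset_with_card_n)
  then obtain x y z where xyz: "L = {x, y, z}" "x \<noteq> y" "x \<noteq> z" "y \<noteq> z"
    by (auto simp: card_3_iff)
  show ?thesis
  proof (rule good_if_three_columns[OF n, of x y z])
    show "{x, y, z} \<subseteq> {0..<N}"
      using L K xyz by blast
    show "\<not> p dvd x - y" "\<not> p dvd x - z" "\<not> p dvd y - z"
      using incong L xyz by blast+
    fix u assume "u \<in> {x, y, z}"
    then have "u \<in> K" "\<not> p dvd \<alpha> * u + \<beta> * (m + \<sigma> * s * (u - n)) + \<gamma>"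
      using L xyz by auto
    then show "[F u (m + \<sigma> * s * (u - n)) = \<alpha> * u + \<beta> * (m + \<sigma> * s * (u - n)) + \<gamma>] (mod p)"
      using good[OF _ s(1), of u] by (auto simp: good_def)
  qed
qed

text \<open>Of the 2001 slopes up to 1000 in absolute value, each of the at most 2000 exceptions
  spoils at most one, because \<open>l - k\<close> is nonzero. The columns are at most 4 apart, so
  the lines stay within \<open>50 + 4 * 1000 = 4050\<close>.\<close>

lemma good_near_window:
  assumes c: "c \<in> {5..p + 4}" and k: "k \<in> {-3, -2, 2, 3}" and t: "t \<in> {-50..50}"
    and few: "(\<Sum>l\<in>{-1, 0, 1}. card {t \<in> {-4050..4050}.
      \<not> [F (c + l) t = \<alpha> * (c + l) + \<beta> * t + \<gamma>] (mod p)}) \<le> 2000"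
  shows "good \<alpha> \<beta> \<gamma> (c + k) t"
proof -
  define B where "B l = {t \<in> {-4050..4050}. \<not> [F (c + l) t = \<alpha> * (c + l) + \<beta> * t + \<gamma>] (mod p)}" for l
  define S where "S l = {s \<in> {-1000..1000}. t + s * (l - k) \<in> B l}" for l
  have finB: "finite (B l)" for l
    by (rule finite_subset[of _ "{-4050..4050}"]) (auto simp: B_def)
  have finS: "finite (S l)" for l
    by (rule finite_subset[of _ "{-1000..1000}"]) (auto simp: S_def)
  have card_S: "card (S l) \<le> card (B l)" if "l \<in> {-1, 0, 1}" for l
  proof (rule card_inj_on_le[of "\<lambda>s. t + s * (l - k)"])
    show "inj_on (\<lambda>s. t + s * (l - k)) (S l)"
      using that k by (auto simp: inj_on_def)
  qed (auto simp: S_def finB)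
  have "\<not> {-1000..1000} \<subseteq> S (- 1) \<union> S 0 \<union> S 1"
  proof
    assume "{-1000..1000} \<subseteq> S (- 1) \<union> S 0 \<union> S 1"
    then have "card {-1000..1000 :: int} \<le> card (S (- 1) \<union> S 0 \<union> S 1)"
      using finS by (intro card_mono) auto
    also have "\<dots> \<le> card (S (- 1)) + card (S 0) + card (S 1)"
      using card_Un_le[of "S (- 1) \<union> S 0" "S 1"] card_Un_le[of "S (- 1)" "S 0"] by linarith
    also have "\<dots> \<le> card (B (- 1)) + card (B 0) + card (B 1)"
      by (intro add_mono card_S) auto
    also have "\<dots> \<le> 2000"
      using few by (simp add: B_def)
    finally show False by simp
  qed
  then obtain s where s: "s \<in> {-1000..1000}" "s \<notin> S (- 1)" "s \<notin> S 0" "s \<notin> S 1"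
    by blast
  have notB: "t + s * (l - k) \<notin> B l" if "l \<in> {-1, 0, 1}" for l
    using s that by (auto simp: S_def)
  show ?thesis
  proof (rule good_if_three_columns[of _ "c + (- 1)" "c + 0" "c + 1"])
    show "c + k \<in> {0..<N}" "{c + (- 1), c + 0, c + 1} \<subseteq> {0..<N}"
      using c k N by auto
    show "\<not> p dvd c + - 1 - (c + 0)" "\<not> p dvd c + - 1 - (c + 1)" "\<not> p dvd c + 0 - (c + 1)"
      using p(2) zdvd_imp_le[of p 1] zdvd_imp_le[of p 2] by auto
    fix u assume "u \<in> {c + (- 1), c + 0, c + 1}"
    then obtain l where l: "l \<in> {-1, 0, 1}" "u = c + l"
      by blast
    have "\<bar>s * (l - k)\<bar> \<le> 1000 * 4"
      unfolding abs_mult using s(1) l(1) k by (intro mult_mono) auto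
    then have "t + s * (l - k) \<in> {-4050..4050}"
      using t by auto
    then have "[F (c + l) (t + s * (l - k)) = \<alpha> * (c + l) + \<beta> * (t + s * (l - k)) + \<gamma>] (mod p)"
      using notB[OF l(1)] unfolding B_def by blast
    then show "[F u (t + s * (u - (c + k))) = \<alpha> * u + \<beta> * (t + s * (u - (c + k))) + \<gamma>] (mod p)"
      by (simp add: l(2))
  qed
qed

text \<open>A block of nine columns is filled before any other column is treated. Nine suffice
  because each of them has four consecutive companions on one side within the block, and because any
  \<open>n\<close> is congruent to at most one of the nine, so that four columns on one side of
  \<open>c\<close> are usable for it.\<close>

lemma good_everywhere_if_window:
  assumes nz: "\<not> (p dvd \<alpha> \<and> p dvd \<beta> \<and> p dvd \<gamma>)" and c: "c \<in> {5..p + 4}"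
    and few: "(\<Sum>l\<in>{-1, 0, 1}. card {t \<in> {-4050..4050}.
      \<not> [F (c + l) t = \<alpha> * (c + l) + \<beta> * t + \<gamma>] (mod p)}) \<le> 2000"
    and n: "n \<in> {0..<N}"
  shows "good \<alpha> \<beta> \<gamma> n m"
proof -
  have near: "x = y" if "p dvd x - y" "\<bar>x - y\<bar> \<le> 10" for x y :: int
    using dvd_diff_imp_eq[OF that(1)] that(2) p(2) by linarith
  have four: "good \<alpha> \<beta> \<gamma> (c + k) t"
    if "k \<in> {-4..4}" "K \<subseteq> {-4..4}" "card K = 4" "k \<notin> K" "\<sigma> \<in> {-1, 1}"
      "\<And>l s. l \<in> K \<Longrightarrow> s \<in> {1..4} \<Longrightarrow> good \<alpha> \<beta> \<gamma> (c + l) (t + \<sigma> * s * (l - k))" for k K \<sigma> t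
  proof (rule good_if_four_columns[OF nz, of "(\<lambda>l. c + l) ` K" _ \<sigma>])
    show "card ((\<lambda>l. c + l) ` K) = 4"
      using that(3) by (subst card_image) auto
    show "x = y" if "x \<in> insert (c + k) ((\<lambda>l. c + l) ` K)" "y \<in> insert (c + k) ((\<lambda>l. c + l) ` K)" "p dvd x - y" for x y
    proof (rule near[OF that(3)])
      have "x - c \<in> {-4..4}" "y - c \<in> {-4..4}"
        using that(1,2) \<open>k \<in> {-4..4}\<close> \<open>K \<subseteq> {-4..4}\<close> by auto
      then show "\<bar>x - y\<bar> \<le> 10"
        by auto
    qed
    show "good \<alpha> \<beta> \<gamma> u (t + \<sigma> * s * (u - (c + k)))" if "u \<in> (\<lambda>l. c + l) ` K" "s \<in> {1..4}" for u s
      using that \<open>\<And>l s. l \<in> K \<Longrightarrow> s \<in> {1..4} \<Longrightarrow> good \<alpha> \<beta> \<gamma> (c + l) (t + \<sigma> * s * (l - k))\<close> by auto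
  qed (use that c N in auto)
  \<comment> \<open>Slopes up to 4 over distances up to 7 move a height by at most 28, and
    \<open>22 + 28 = 50\<close> is the range of \<open>good_near_window\<close>.\<close>
  have start: "good \<alpha> \<beta> \<gamma> (c + k) t" if k: "k \<in> {-4..4}" and t: "t \<in> {-22..22}" for k t
  proof (cases "k \<in> {-3, -2, 2, 3}")
    case True
    then show ?thesis
      using good_near_window[OF c _ _ few, of k t] t by auto
  next
    case False
    show ?thesis
    proof (rule four[OF k, of "{-3, -2, 2, 3}" 1])
      fix l s assume ls: "l \<in> {-3, -2, 2, 3 :: int}" "s \<in> {1..4 :: int}"
      have "\<bar>s * (l - k)\<bar> \<le> 4 * 7"
        unfolding abs_mult using ls k by (intro mult_mono) auto
      then show "good \<alpha> \<beta> \<gamma> (c + l) (t + 1 * s * (l - k))"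
        using t ls by (intro good_near_window[OF c _ _ few]) auto
    qed (use False in auto)
  qed
  have grow: "\<forall>k\<in>{-4..4}. \<forall>t. \<bar>t\<bar> \<le> 22 + int r \<longrightarrow> good \<alpha> \<beta> \<gamma> (c + k) t" for r
  proof (induction r)
    case 0
    show ?case
      by (intro ballI allI impI start) (auto simp: abs_le_iff)
  next
    case (Suc r)
    have "good \<alpha> \<beta> \<gamma> (c + k) t" if k: "k \<in> {-4..4}" and t: "\<bar>t\<bar> = 23 + int r" for k t
    proof -
      \<comment> \<open>\<open>\<epsilon>\<close> selects the side with four columns inside the
        block. With the sign \<open>\<epsilon> * \<tau>\<close> the lines bend from the new cell
        into the known strip: at distance \<open>d\<close> they have come in by
        \<open>s * d\<close>, between 1 and 16.\<close>
      define \<epsilon> :: int where "\<epsilon> = (if k \<ge> 0 then 1 else - 1)"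
      define \<tau> :: int where "\<tau> = (if t \<ge> 0 then 1 else - 1)"
      have eps: "\<epsilon> = 1 \<or> \<epsilon> = - 1" and tau: "\<tau> = 1 \<or> \<tau> = - 1"
        by (auto simp: \<epsilon>_def \<tau>_def)
      have tt: "t = \<tau> * (23 + int r)"
        using t by (auto simp: \<tau>_def)
      show ?thesis
      proof (rule four[OF k, of "(\<lambda>d. k - \<epsilon> * d) ` {1..4}" "\<epsilon> * \<tau>"])
        show "card ((\<lambda>d. k - \<epsilon> * d) ` {1..4}) = 4"
          using eps by (subst card_image) (auto simp: inj_on_def)
        fix l s assume l: "l \<in> (\<lambda>d. k - \<epsilon> * d) ` {1..4}" and s: "s \<in> {1..4 :: int}"
        then obtain d where d: "d \<in> {1..4}" "l = k - \<epsilon> * d"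
          by blast
        have "\<epsilon> * \<epsilon> = 1"
          using eps by auto
        then have "t + \<epsilon> * \<tau> * s * (l - k) = \<tau> * (23 + int r - s * d)"
          using mult.assoc[of \<epsilon> \<epsilon>] by (simp add: tt d(2) algebra_simps)
        moreover have "1 * 1 \<le> s * d" "s * d \<le> 4 * 4"
          using s d by (intro mult_mono; simp)+
        ultimately have "\<bar>t + \<epsilon> * \<tau> * s * (l - k)\<bar> \<le> 22 + int r"
          using tau by auto
        moreover have "l \<in> {-4..4}"
          using d k by (auto simp: \<epsilon>_def)
        ultimately show "good \<alpha> \<beta> \<gamma> (c + l) (t + \<epsilon> * \<tau> * s * (l - k))"
          using Suc by blast
      qed (use k eps tau in \<open>auto simp: \<epsilon>_def split: if_splits\<close>)
    qed
    then show ?case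
    proof (intro ballI allI impI)
      fix k t :: int assume k: "k \<in> {-4..4}" and "\<bar>t\<bar> \<le> 22 + int (Suc r)"
      then have "\<bar>t\<bar> \<le> 22 + int r \<or> \<bar>t\<bar> = 23 + int r"
        by auto
      then show "good \<alpha> \<beta> \<gamma> (c + k) t"
        using Suc k \<open>\<And>k t. k \<in> {-4..4} \<Longrightarrow> \<bar>t\<bar> = 23 + int r \<Longrightarrow> good \<alpha> \<beta> \<gamma> (c + k) t\<close> by blast
    qed
  qed
  have cols: "good \<alpha> \<beta> \<gamma> (c + k) t" if "k \<in> {-4..4}" for k t
    using grow[of "nat \<bar>t\<bar>"] that by auto
  obtain K where K: "K = {1..4} \<or> K = {-4..-1}" "\<And>l. l \<in> K \<Longrightarrow> \<not> p dvd n - (c + l)"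
  proof (cases "\<exists>l\<in>{1..4}. p dvd n - (c + l)")
    case False
    then show ?thesis
      using that[of "{1..4}"] by blast
  next
    case True
    then obtain l where l: "l \<in> {1..4}" "p dvd n - (c + l)" by blast
    have "\<not> p dvd n - (c + l')" if "l' \<in> {-4..-1}" for l'
    proof
      assume "p dvd n - (c + l')"
      then have "p dvd (n - (c + l')) - (n - (c + l))"
        using l(2) by (rule dvd_diff)
      then have "p dvd l - l'" by simp
      then show False
        using near[of l l'] l that by auto
    qed
    then show ?thesis
      using that[of "{-4..-1}"] by blast
  qed
  show ?thesis
  proof (rule good_if_four_columns[OF nz, of "(\<lambda>l. c + l) ` K" n 1])
    show "card ((\<lambda>l. c + l) ` K) = 4"
      using K by (subst card_image) auto
    show "x = y" if "x \<in> insert n ((\<lambda>l. c + l) ` K)" "y \<in> insert n ((\<lambda>l. c + l) ` K)" "p dvd x - y" for x y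
      using that K by (auto intro!: near simp: dvd_diff_commute abs_le_iff)
    show "n \<notin> (\<lambda>l. c + l) ` K"
      using K(2)[of "n - c"] by auto
    show "good \<alpha> \<beta> \<gamma> u (m + 1 * s * (u - n))" if "u \<in> (\<lambda>l. c + l) ` K" for u s
      using that K cols by auto
  qed (use K c N n in auto)
qed

end

lemma affine_lines_substitute:
  assumes "affine_lines p N F"
  shows "affine_lines p N (\<lambda>n m. F n (q * m + \<alpha> * n + \<beta>))"
  unfolding affine_lines_def
proof (intro allI)
  fix j i
  have eq: "q * (j * n + i) + \<alpha> * n + \<beta> = (q * j + \<alpha>) * n + (q * i + \<beta>)" for n
    by (simp add: algebra_simps)
  show "\<exists>a b. \<not> (p dvd a \<and> p dvd b) \<and> (\<forall>n\<in>{0..<N}. \<not> p dvd a * n + b \<longrightarrow>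
      [F n (q * (j * n + i) + \<alpha> * n + \<beta>) = a * n + b] (mod p))"
    using assms unfolding affine_lines_def eq by blast
qed

context affine_lines_array
begin

text \<open>The windows found by averaging follow a line of slope \<open>j\<close>. A shear brings
  them to a common height, where \<open>good_everywhere_if_window\<close> applies, and the resulting
  form is sheared back.\<close>

lemma exists_affine_form:
  "\<exists>\<alpha> \<beta> \<gamma>. \<not> (p dvd \<alpha> \<and> p dvd \<beta> \<and> p dvd \<gamma>) \<and> (\<forall>n\<in>{0..<N}. \<forall>m. good \<alpha> \<beta> \<gamma> n m)"
proof -
  define H M J :: int where "H = 4050" and "M = 10000 * H" and "J = 10000 * M"
  obtain c r where c: "c \<in> {5..p + 4}"
    and E: "35 * int (card (sampled_box.bad p H M J (\<lambda>k m. F (c + k) (r + m)) 0)) \<le> 3 * (M * J)"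
      "16 * card (sampled_box.bad p H M J (\<lambda>k m. F (c + k) (r + m)) (- 1)) +
       19 * card (sampled_box.bad p H M J (\<lambda>k m. F (c + k) (r + m)) 0) +
       16 * card (sampled_box.bad p H M J (\<lambda>k m. F (c + k) (r + m)) 1) \<le> (293 / 100 :: real) * (M * J)"
    using exists_sparse_box[OF p N lines _ M_def J_def] unfolding Let_def by (auto simp: H_def)
  interpret sampled_box p H M J "\<lambda>k m. F (c + k) (r + m)"
    using p primes_dvd_imp_eq[of 2 p] by unfold_locales (auto simp: H_def M_def J_def)
  obtain m j v a B where "12 * real (\<Sum>k\<in>{-1, 0, 1}.
      card {t \<in> {-H..H}. \<not> [F (c + k) (r + (m + k * j + t)) = v + a * k + B * t] (mod p)}) \<le> 293 / 100 * (2 * H + 1)"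
    using exists_affine_window[OF E] by auto
  \<comment> \<open>A window has 8101 places, and \<open>2.93 * 8101 / 12\<close> is below
    1978.\<close>
  then have few: "(\<Sum>k\<in>{-1, 0, 1}.
      card {t \<in> {-4050..4050}. \<not> [F (c + k) (r + (m + k * j + t)) = v + a * k + B * t] (mod p)}) \<le> 2000"
    unfolding H_def by simp
  define s where "s = r + m - c * j"
  interpret sheared: affine_lines_array p N "\<lambda>n t. F n (1 * t + j * n + s)"
    using p N affine_lines_substitute[OF lines, of 1 j s] nonzero by unfold_locales auto
  have "1 * t + j * (c + l) + s = r + (m + l * j + t)" "a * (c + l) + B * t + (v - a * c) = v + a * l + B * t" for t l
    by (simp_all add: s_def algebra_simps)
  note shift = this
  have few': "(\<Sum>l\<in>{-1, 0, 1}. card {t \<in> {-4050..4050}.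
      \<not> [F (c + l) (1 * t + j * (c + l) + s) = a * (c + l) + B * t + (v - a * c)] (mod p)}) \<le> 2000"
    unfolding shift by (rule few)
  \<comment> \<open>The zero form agrees with \<open>F\<close> nowhere, so the middle column alone
    would have 8101 exceptions.\<close>
  have nz: "\<not> (p dvd a \<and> p dvd B \<and> p dvd v - a * c)"
  proof
    assume dvd: "p dvd a \<and> p dvd B \<and> p dvd v - a * c"
    have "\<not> [F (c + 0) (1 * t + j * (c + 0) + s) = a * (c + 0) + B * t + (v - a * c)] (mod p)" for t
    proof
      assume "[F (c + 0) (1 * t + j * (c + 0) + s) = a * (c + 0) + B * t + (v - a * c)] (mod p)"
      moreover have "p dvd a * (c + 0) + B * t + (v - a * c)"
        using dvd by (intro dvd_add dvd_mult2) auto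
      ultimately have "p dvd F (c + 0) (1 * t + j * (c + 0) + s)"
        by (simp only: cong_dvd_iff)
      then show False
        using nonzero[of "c + 0"] c N by auto
    qed
    then have eq: "{t \<in> {-4050..4050}.
      \<not> [F (c + 0) (1 * t + j * (c + 0) + s) = a * (c + 0) + B * t + (v - a * c)] (mod p)} = {-4050..4050}"
      by blast
    have "card {t \<in> {-4050..4050}.
      \<not> [F (c + 0) (1 * t + j * (c + 0) + s) = a * (c + 0) + B * t + (v - a * c)] (mod p)} = 8101"
      unfolding eq by simp
    then show False
      using few' by simp
  qed
  have "good (a - B * j) B (v - a * c - B * s) n m" if "n \<in> {0..<N}" for n m
  proof -
    have "sheared.good a B (v - a * c) n (m - j * n - s)"
      by (rule sheared.good_everywhere_if_window[OF nz c few' that])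
    then show ?thesis
      unfolding sheared.good_def good_def by (simp add: algebra_simps)
  qed
  moreover have "\<not> (p dvd a - B * j \<and> p dvd B \<and> p dvd v - a * c - B * s)"
    using nz by (auto simp: dvd_diff_left_iff dvd_diff_right_iff)
  ultimately show ?thesis
    by blast
qed

end

section \<open>Rescaling\<close>

lemma card_affine_zeros_le:
  fixes p :: int
  assumes "prime p" "\<not> (p dvd a \<and> p dvd b)" "y < x + p"
  shows "card {s \<in> {x..y}. p dvd a * s + b} \<le> 1"
proof -
  have "finite {s \<in> {x..y}. p dvd a * s + b}"
    by (rule finite_subset[of _ "{x..y}"]) auto
  moreover have "s = s'" if "s \<in> {x..y}" "s' \<in> {x..y}" "p dvd a * s + b" "p dvd a * s' + b" for s s'
  proof (rule dvd_diff_imp_eq)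
    show "p dvd s - s'"
      using prime_dvd_affine_imp[OF assms(1) that(3,4)] assms(2) by blast
    show "\<bar>s - s'\<bar> < p"
      using that assms(3) by auto
  qed
  ultimately show ?thesis
    unfolding One_nat_def by (subst card_le_Suc0_iff_eq) blast+
qed

text \<open>Each function has at most one zero among four points, so at least two agreements remain,
  one more than a nonzero difference allows.\<close>

lemma affine_eq_if_agree_off_zeros:
  fixes p :: int
  assumes p: "prime p" "p > 3" and nz: "\<not> (p dvd a \<and> p dvd b)" "\<not> (p dvd a' \<and> p dvd b')"
    and agree: "\<And>u. u \<in> {0..3} \<Longrightarrow> \<not> p dvd a * u + b \<Longrightarrow> \<not> p dvd a' * u + b' \<Longrightarrow> [a * u + b = a' * u + b'] (mod p)"
  shows "p dvd a - a' \<and> p dvd b - b'"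
proof -
  let ?Z = "{u \<in> {0..3}. p dvd a * u + b}" and ?Z' = "{u \<in> {0..3}. p dvd a' * u + b'}"
    and ?D = "{u \<in> {0..3}. p dvd (a - a') * u + (b - b')}"
  have fin: "finite ?Z" "finite ?Z'" "finite ?D"
    by (rule finite_subset[of _ "{0..3}"], auto)+
  have "{0..3} \<subseteq> ?Z \<union> ?Z' \<union> ?D"
  proof
    fix u :: int assume u: "u \<in> {0..3}"
    have "p dvd (a - a') * u + (b - b')" if "[a * u + b = a' * u + b'] (mod p)"
      using that by (simp add: cong_iff_dvd_diff algebra_simps)
    then show "u \<in> ?Z \<union> ?Z' \<union> ?D"
      using agree[OF u] u by blast
  qed
  then have "card {0..3 :: int} \<le> card (?Z \<union> ?Z' \<union> ?D)"
    using fin by (intro card_mono) blast+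
  also have "\<dots> \<le> card ?Z + card ?Z' + card ?D"
    using card_Un_le[of "?Z \<union> ?Z'" ?D] card_Un_le[of ?Z ?Z'] by linarith
  finally have "card ?D \<ge> 2"
    using card_affine_zeros_le[OF p(1) nz(1), of 3 0] card_affine_zeros_le[OF p(1) nz(2), of 3 0] p(2) by simp
  then show ?thesis
    using card_affine_zeros_le[OF p(1), of "a - a'" "b - b'" 3 0] p(2) by linarith
qed

lemma exists_affine_root:
  fixes p B C :: int
  assumes "prime p" "\<not> p dvd B"
  shows "\<exists>x. p dvd C + B * x"
proof -
  have "coprime B p"
    using assms prime_imp_coprime coprime_commute by blast
  then obtain y where "[B * y = 1] (mod p)"
    using cong_solve_coprime_int by blast
  then have "p dvd C * (B * y - 1)"
    by (simp add: cong_iff_dvd_diff)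
  then have "p dvd - (C * (B * y - 1))"
    by simp
  then have "p dvd C + B * (- C * y)"
    by (simp add: algebra_simps)
  then show ?thesis ..
qed

text \<open>Valuations 0 and 1 are expressed by divisibility of integers. Non-constant columns are
  included so that the assumptions as a whole can be shown stable under rescaling.\<close>

locale sudoku_array =
  fixes p N :: int and F :: "int \<Rightarrow> int \<Rightarrow> int"
  assumes p: "prime p" "p \<ge> 53" and N: "N \<ge> p ^ 2"
    and range: "n \<in> {0..<N} \<Longrightarrow> F n m \<in> {0<..<p}"
    and lines: "\<exists>a b. \<not> (p dvd a \<and> p dvd b) \<and> (\<forall>n\<in>{0..<N}.
      (\<not> p dvd a * n + b \<longrightarrow> [F n (j * n + i) = a * n + b] (mod p)) \<and>
      (p dvd a * n + b \<and> \<not> p ^ 2 dvd a * n + b \<longrightarrow> [F n (j * n + i) = (a * n + b) div p] (mod p)))"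
    and columns: "n \<in> {0..<N} \<Longrightarrow> \<exists>m m'. F n m \<noteq> F n m'"
begin

definition affine_form :: "int \<Rightarrow> int \<Rightarrow> int \<Rightarrow> bool" where
  "affine_form A B C \<longleftrightarrow>
    (\<forall>n\<in>{0..<N}. \<forall>m. \<not> p dvd A * n + B * m + C \<longrightarrow> [F n m = A * n + B * m + C] (mod p))"

lemma N_large: "N \<ge> 53 * p"
proof -
  have "53 * p \<le> p * p"
    using p(2) by (intro mult_right_mono) auto
  then show ?thesis
    using N by (simp add: power2_eq_square)
qed

lemma eq_if_cong:
  assumes "n \<in> {0..<N}" "n' \<in> {0..<N}" "[F n m = F n' m'] (mod p)"
  shows "F n m = F n' m'"
  using assms range[of n m] range[of n' m'] by (auto simp: cong_def)

lemma exists_affine_form: "\<exists>A B C. \<not> p dvd B \<and> affine_form A B C"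
proof -
  interpret affine_lines_array p N F
  proof
    show "affine_lines p N F"
      unfolding affine_lines_def using lines by meson
    show "\<not> p dvd F n m" if "n \<in> {0..<N}" for n m
      using range[OF that, of m] zdvd_imp_le[of p "F n m"] by auto
  qed (use p N_large in auto)
  obtain A B C where nz: "\<not> (p dvd A \<and> p dvd B \<and> p dvd C)" and g: "\<forall>n\<in>{0..<N}. \<forall>m. good A B C n m"
    using exists_affine_form by blast
  have "\<not> p dvd B"
  proof
    assume B: "p dvd B"
    have "\<exists>n\<in>{0, 1}. \<not> p dvd A * n + C"
    proof (rule ccontr)
      assume "\<not> ?thesis"
      then have "p dvd A * 0 + C" "p dvd A * 1 + C"
        by auto
      then have "p dvd A \<and> p dvd C"
        using prime_dvd_affine_imp[OF p(1), of A 1 C 0] p by auto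
      then show False
        using nz B by blast
    qed
    then obtain n where n: "n \<in> {0, 1}" "\<not> p dvd A * n + C" by blast
    then have nN: "n \<in> {0..<N}"
      using N_large p by auto
    have "[F n m = A * n + C] (mod p)" for m
    proof -
      have eq: "[A * n + B * m + C = A * n + C] (mod p)"
        using B by (simp add: cong_iff_dvd_diff)
      then have "\<not> p dvd A * n + B * m + C"
        using n(2) by (simp add: cong_dvd_iff)
      then have "[F n m = A * n + B * m + C] (mod p)"
        using g nN unfolding good_def by blast
      then show ?thesis
        using eq by (rule cong_trans)
    qed
    then have "[F n m = F n m'] (mod p)" for m m'
      unfolding cong_def by metis
    then show False
      using columns[OF nN] eq_if_cong[OF nN nN] by blast
  qed
  then show ?thesis
    using g unfolding affine_form_def good_def by blast
qed

definition rescale :: "int \<Rightarrow> int \<Rightarrow> int \<Rightarrow> int \<Rightarrow> int" where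
  "rescale \<alpha> \<gamma> n m = F n (p * m + \<alpha> * n + \<gamma>)"

context
  fixes B \<alpha> \<gamma> :: int
  assumes B: "\<not> p dvd B"
    and form: "n \<in> {0..<N} \<Longrightarrow> \<not> p dvd m - \<alpha> * n - \<gamma> \<Longrightarrow> [F n m = B * (m - \<alpha> * n - \<gamma>)] (mod p)"
begin

abbreviation rescaled :: "int \<Rightarrow> int \<Rightarrow> int" where
  "rescaled \<equiv> rescale \<alpha> \<gamma>"

text \<open>
  The line of slope \<open>\<alpha> + s\<close> through a zero of the affine form meets the zeros exactly in the columns
  congruent to \<open>n\<close>, where the values of valuation one of its rule determine \<open>F\<close>.
\<close>

lemma rescaled_along_line:
  assumes n: "n \<in> {0..<p}" and s: "\<not> p dvd s"
  shows "\<exists>b. \<forall>k. n + p * k \<in> {0..<N} \<longrightarrow> \<not> p dvd B * s * k + b \<longrightarrow>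
    [rescaled (n + p * k) (m + s * k) = B * s * k + b] (mod p)"
proof -
  define j i where "j = \<alpha> + s" and "i = p * m + \<alpha> * n + \<gamma> - j * n"
  obtain a b where ab: "\<not> (p dvd a \<and> p dvd b)"
    and val0: "\<And>u. u \<in> {0..<N} \<Longrightarrow> \<not> p dvd a * u + b \<Longrightarrow> [F u (j * u + i) = a * u + b] (mod p)"
    and val1: "\<And>u. u \<in> {0..<N} \<Longrightarrow> p dvd a * u + b \<Longrightarrow> \<not> p ^ 2 dvd a * u + b \<Longrightarrow>
      [F u (j * u + i) = (a * u + b) div p] (mod p)"
    using lines[of j i] by blast
  have Bs: "\<not> p dvd B * s"
    using B s p(1) by (simp add: prime_dvd_mult_iff)
  have line: "B * s * u + B * (i - \<gamma>) = B * (j * u + i - \<alpha> * u - \<gamma>)" for u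
    by (simp add: j_def algebra_simps)
  \<comment> \<open>The pair supplied by the rule is known only through values off its zeros, as is
    the form along the line; the columns 0 to 3 are enough to match them.\<close>
  have "p dvd a - B * s \<and> p dvd b - B * (i - \<gamma>)"
  proof (rule affine_eq_if_agree_off_zeros[OF p(1) _ ab, of "B * s" "B * (i - \<gamma>)"], goal_cases)
    case (3 u)
    then have u: "u \<in> {0..<N}" 
      using N_large p by auto
    have "\<not> p dvd j * u + i - \<alpha> * u - \<gamma>"
      using 3(3) unfolding line by auto
    from form[OF u this] val0[OF u 3(2)] show ?case
      unfolding line cong_def by simp
  qed (use p Bs in auto)
  then have aB: "[a = B * s] (mod p)" and bB: "[b = B * (i - \<gamma>)] (mod p)"
    by (simp_all add: cong_iff_dvd_diff)
  have "[a * n + b = B * s * n + B * (i - \<gamma>)] (mod p)"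
    by (intro cong_add cong_mult aB bB cong_refl)
  also have "B * s * n + B * (i - \<gamma>) = p * (B * m)"
    by (simp add: i_def j_def algebra_simps)
  finally have "p dvd a * n + b"
    by (simp add: cong_dvd_iff)
  \<comment> \<open>\<open>b'\<close> depends on \<open>a\<close> and \<open>b\<close> beyond their
    residues, so the constant term stays unknown. The slope in \<open>k\<close> is \<open>a\<close>,
    congruent to \<open>B * s\<close>.\<close>
  then obtain b' where b': "a * n + b = p * b'" ..
  have "[rescaled (n + p * k) (m + s * k) = B * s * k + b'] (mod p)"
    if k: "n + p * k \<in> {0..<N}" "\<not> p dvd B * s * k + b'" for k
  proof -
    have c: "[a * k + b' = B * s * k + b'] (mod p)"
      by (intro cong_add cong_mult aB cong_refl)
    have eq: "a * (n + p * k) + b = p * (a * k + b')"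
      using b' by (simp add: algebra_simps)
    have "\<not> p dvd a * k + b'"
      using k(2) c by (simp add: cong_dvd_iff)
    then have "[F (n + p * k) (j * (n + p * k) + i) = a * k + b'] (mod p)"
      using val1[OF k(1)] p unfolding eq by (simp add: power2_eq_square)
    moreover have "j * (n + p * k) + i = p * (m + s * k) + \<alpha> * (n + p * k) + \<gamma>"
      by (simp add: i_def j_def algebra_simps)
    ultimately show ?thesis
      using c unfolding rescale_def cong_def by simp
  qed
  then show ?thesis by blast
qed

text \<open>Suppose column \<open>n\<close> is constant with value \<open>c\<close>. Join a fixed
  cell of the column at distance \<open>p\<close>, with value \<open>V\<close>, to column
  \<open>n\<close> by lines with \<open>s = 1, \<dots>, 4\<close>. If the line vanishes in column
  \<open>n\<close>, then \<open>B * \<epsilon> * s\<close> is congruent to \<open>V\<close>; if it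
  vanishes at the fixed cell, to \<open>- c\<close>; otherwise to \<open>V - c\<close>. Each case
  admits at most one \<open>s\<close>, so four slopes are too many.\<close>

lemma rescaled_columns:
  assumes n: "n \<in> {0..<N}"
  shows "\<exists>m m'. rescaled n m \<noteq> rescaled n m'"
proof (rule ccontr)
  assume "\<not> ?thesis"
  then obtain c where c: "rescaled n m = c" for m
    by metis
  define n0 k where "n0 = n mod p" and "k = n div p"
  have nk: "n = n0 + p * k" and n0: "n0 \<in> {0..<p}"
    using p by (auto simp: n0_def k_def)
  obtain \<epsilon> :: int where \<epsilon>: "\<epsilon> \<in> {-1, 1}" "n0 + p * (k + \<epsilon>) \<in> {0..<N}"
  proof (cases "n < p")
    case True
    then have "n0 + p * (k + 1) \<in> {0..<N}"
      using n N_large p by (auto simp: algebra_simps nk)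
    then show ?thesis
      using that[of 1] by simp
  next
    case False
    then have "n0 + p * (k + (- 1)) \<in> {0..<N}"
      using n p by (auto simp: algebra_simps nk)
    then show ?thesis
      using that[of "- 1"] by simp
  qed
  define V where "V = rescaled (n0 + p * (k + \<epsilon>)) 0"
  have B\<epsilon>: "\<not> p dvd B * \<epsilon>"
    using B \<epsilon> by auto
  have three: "p dvd B * \<epsilon> * s + - V \<or> p dvd B * \<epsilon> * s + c \<or> p dvd B * \<epsilon> * s + (c - V)" if s: "s \<in> {1..4}" for s
  proof -
    have ps: "\<not> p dvd s"
      using s p zdvd_imp_le[of p s] by auto
    obtain b where b: "\<And>l. n0 + p * l \<in> {0..<N} \<Longrightarrow> \<not> p dvd B * s * l + b \<Longrightarrow>
        [rescaled (n0 + p * l) (- (s * (k + \<epsilon>)) + s * l) = B * s * l + b] (mod p)"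
      using rescaled_along_line[OF n0 ps] by blast
    define e where "e = B * s * k + b"
    have ce: "[c = e] (mod p)" if "\<not> p dvd e"
      using b[of k] that n by (simp add: e_def c flip: nk)
    have "B * s * (k + \<epsilon>) + b = e + B * \<epsilon> * s"
      by (simp add: e_def algebra_simps)
    then have Ve: "[V = e + B * \<epsilon> * s] (mod p)" if "\<not> p dvd e + B * \<epsilon> * s"
      using b[OF \<epsilon>(2)] that by (simp add: V_def)
    show ?thesis
    proof (cases "p dvd e")
      case True
      then have "\<not> p dvd e + B * \<epsilon> * s"
        using B\<epsilon> ps p(1) by (simp add: dvd_add_right_iff prime_dvd_mult_iff)
      from Ve[OF this] have "p dvd V - (e + B * \<epsilon> * s)"
        by (simp add: cong_iff_dvd_diff)
      then have "p dvd - (V - (e + B * \<epsilon> * s)) - e"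
        using True by (intro dvd_diff) (simp_all only: dvd_minus_iff)
      moreover have "- (V - (e + B * \<epsilon> * s)) - e = B * \<epsilon> * s + - V"
        by simp
      ultimately show ?thesis
        by metis
    next
      case False
      from ce[OF this] have "p dvd c - e"
        by (simp add: cong_iff_dvd_diff)
      show ?thesis
      proof (cases "p dvd e + B * \<epsilon> * s")
        case True
        then have "p dvd (e + B * \<epsilon> * s) + (c - e)"
          using \<open>p dvd c - e\<close> by (rule dvd_add)
        then show ?thesis
          by (simp add: algebra_simps)
      next
        case False
        from Ve[OF this] have "p dvd V - (e + B * \<epsilon> * s)"
          by (simp add: cong_iff_dvd_diff)
        with \<open>p dvd c - e\<close> have "p dvd (c - e) - (V - (e + B * \<epsilon> * s))"
          by (rule dvd_diff)
        then show ?thesis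
          by (simp add: algebra_simps)
      qed
    qed
  qed
  let ?Z = "\<lambda>b. {s \<in> {1..4}. p dvd B * \<epsilon> * s + b}"
  have fin: "finite (?Z b)" for b
    by (rule finite_subset[of _ "{1..4}"]) auto
  have "{1..4} \<subseteq> ?Z (- V) \<union> ?Z c \<union> ?Z (c - V)"
    using three by blast
  then have "card {1..4 :: int} \<le> card (?Z (- V) \<union> ?Z c \<union> ?Z (c - V))"
    using fin by (intro card_mono finite_UnI)
  also have "\<dots> \<le> card (?Z (- V)) + card (?Z c) + card (?Z (c - V))"
    using card_Un_le[of "?Z (- V) \<union> ?Z c" "?Z (c - V)"] card_Un_le[of "?Z (- V)" "?Z c"] by linarith
  also have "\<dots> \<le> 1 + 1 + 1"
    using B\<epsilon> p by (intro add_mono card_affine_zeros_le) auto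
  finally show False
    by simp
qed

lemma sudoku_array_rescaled: "sudoku_array p N rescaled"
proof
  fix j i
  have eq: "p * (j * n + i) + \<alpha> * n + \<gamma> = (p * j + \<alpha>) * n + (p * i + \<gamma>)" for n
    by (simp add: algebra_simps)
  show "\<exists>a b. \<not> (p dvd a \<and> p dvd b) \<and> (\<forall>n\<in>{0..<N}.
      (\<not> p dvd a * n + b \<longrightarrow> [rescaled n (j * n + i) = a * n + b] (mod p)) \<and>
      (p dvd a * n + b \<and> \<not> p ^ 2 dvd a * n + b \<longrightarrow> [rescaled n (j * n + i) = (a * n + b) div p] (mod p)))"
    unfolding rescale_def eq by (rule lines)
qed (use p N range rescaled_columns in \<open>simp_all add: rescale_def\<close>)

text \<open>On the cells \<open>(p * u, u)\<close> the term with \<open>A\<close> vanishes modulo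
  \<open>p\<close>, so the new form reads \<open>B' * u + C\<close>, while the line with
  \<open>n = 0\<close> and \<open>s = 1\<close> gives \<open>B * u + b\<close>.\<close>

lemma rescaled_affine_form: "\<exists>A C. sudoku_array.affine_form p N rescaled A B C"
proof -
  interpret r: sudoku_array p N rescaled
    by (rule sudoku_array_rescaled)
  obtain A B' C where B': "\<not> p dvd B'" and r: "r.affine_form A B' C"
    using r.exists_affine_form by blast
  obtain b where b: "\<And>k. 0 + p * k \<in> {0..<N} \<Longrightarrow> \<not> p dvd B * 1 * k + b \<Longrightarrow>
      [rescaled (0 + p * k) (0 + 1 * k) = B * 1 * k + b] (mod p)"
    using rescaled_along_line[of 0 1 0] p by (auto simp: not_prime_unit)
  have agree: "[B * u + b = B' * u + C] (mod p)"
    if u: "u \<in> {0..3}" "\<not> p dvd B * u + b" "\<not> p dvd B' * u + C" for u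
  proof -
    have "p * u \<le> p * 3" "0 \<le> p * u"
      using u p by (intro mult_left_mono mult_nonneg_nonneg; simp)+
    then have uN: "p * u \<in> {0..<N}"
      unfolding atLeastLessThan_iff using N_large p(2) by linarith
    have eq: "[A * (p * u) + B' * u + C = B' * u + C] (mod p)"
      by (simp add: cong_iff_dvd_diff)
    then have "\<not> p dvd A * (p * u) + B' * u + C"
      using u(3) by (simp add: cong_dvd_iff)
    then have "[rescaled (p * u) u = A * (p * u) + B' * u + C] (mod p)"
      using r uN unfolding r.affine_form_def by blast
    moreover have "[rescaled (p * u) u = B * u + b] (mod p)"
      using b[of u] uN u by simp
    ultimately show ?thesis
      using eq unfolding cong_def by simp
  qed
  have "p dvd B - B'"
    by (rule affine_eq_if_agree_off_zeros[THEN conjunct1, OF p(1) _ _ _ agree]) (use p B B' in auto)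
  then have "[A * n + B * m + C = A * n + B' * m + C] (mod p)" for n m
    by (intro cong_add cong_mult cong_refl) (simp add: cong_iff_dvd_diff)
  then have "r.affine_form A B C"
    using r unfolding r.affine_form_def by (meson cong_dvd_iff cong_sym cong_trans)
  then show ?thesis by blast
qed

end

text \<open>The invariant \<open>P\<close> of the dependent choice demands an affine form with the
  \<open>B\<close> of the first stage. The shifts \<open>a K\<close>, \<open>c K\<close> are partial
  p-adic expansions of the line of zeros; stage \<open>K\<close> decides the cells whose distance
  from that line has valuation exactly \<open>K\<close>.\<close>

lemma exists_padic_lines:
  "\<exists>B a c. \<not> p dvd B \<and> (\<forall>K. p ^ K dvd a (Suc K) - a K \<and> p ^ K dvd c (Suc K) - c K) \<and>
    (\<forall>K. \<forall>n\<in>{0..<N}. \<forall>m y. m - a (Suc K) * n - c (Suc K) = p ^ K * y \<longrightarrow> \<not> p dvd y \<longrightarrow> [F n m = B * y] (mod p))"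
proof -
  obtain A0 B C0 where B: "\<not> p dvd B" and form0: "affine_form A0 B C0"
    using exists_affine_form by blast
  define G where "G K z = (\<lambda>n m. F n (p ^ K * m + fst z * n + snd z))" for K and z :: "int \<times> int"
  define P where "P K z \<longleftrightarrow> sudoku_array p N (G K z) \<and> (\<exists>A C. sudoku_array.affine_form p N (G K z) A B C)"
    for K z
  define Q where "Q K z z' \<longleftrightarrow> (\<exists>\<alpha> \<gamma>. z' = (fst z + p ^ K * \<alpha>, snd z + p ^ K * \<gamma>) \<and>
      (\<forall>n\<in>{0..<N}. \<forall>m. \<not> p dvd m - \<alpha> * n - \<gamma> \<longrightarrow> [G K z n m = B * (m - \<alpha> * n - \<gamma>)] (mod p)))"
    for K z z'
  have "\<exists>z. \<forall>K. P K (z K) \<and> Q K (z K) (z (Suc K))"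
  proof (rule dependent_nat_choice)
    have "G 0 (0, 0) = F"
      by (simp add: G_def)
    then show "\<exists>z. P 0 z"
      using form0 sudoku_array_axioms by (intro exI[of _ "(0, 0)"]) (auto simp: P_def)
  next
    fix z K assume "P K z"
    then obtain A C where sud: "sudoku_array p N (G K z)" and form: "sudoku_array.affine_form p N (G K z) A B C"
      unfolding P_def by blast
    interpret g: sudoku_array p N "G K z"
      by (rule sud)
    obtain \<alpha> \<gamma> where \<alpha>: "p dvd A + B * \<alpha>" and \<gamma>: "p dvd C + B * \<gamma>"
      using exists_affine_root[OF p(1) B] by meson
    have eq: "[A * n + B * m + C = B * (m - \<alpha> * n - \<gamma>)] (mod p)" for n m
    proof -
      have "p dvd (A + B * \<alpha>) * n + (C + B * \<gamma>)"
        using \<alpha> \<gamma> by simp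
      then show ?thesis
        by (simp add: cong_iff_dvd_diff algebra_simps)
    qed
    have val: "[G K z n m = B * (m - \<alpha> * n - \<gamma>)] (mod p)" if "n \<in> {0..<N}" "\<not> p dvd m - \<alpha> * n - \<gamma>" for n m
    proof -
      have "\<not> p dvd A * n + B * m + C"
        using eq[of n m] that(2) B p(1) by (simp add: cong_dvd_iff prime_dvd_mult_iff)
      then have "[G K z n m = A * n + B * m + C] (mod p)"
        using form that(1) unfolding g.affine_form_def by blast
      then show ?thesis
        using eq by (rule cong_trans)
    qed
    define z' where "z' = (fst z + p ^ K * \<alpha>, snd z + p ^ K * \<gamma>)"
    have "G (Suc K) z' = g.rescale \<alpha> \<gamma>"
      by (intro ext, simp only: g.rescale_def) (simp add: G_def z'_def algebra_simps)
    then have "P (Suc K) z'"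
      unfolding P_def using g.sudoku_array_rescaled[OF B val] g.rescaled_affine_form[OF B val] by simp
    moreover have "Q K z z'"
      unfolding Q_def z'_def using val by blast
    ultimately show "\<exists>z'. P (Suc K) z' \<and> Q K z z'" by blast
  qed
  then obtain z where z: "\<And>K. Q K (z K) (z (Suc K))" by blast
  show ?thesis
  proof (rule exI[of _ B], rule exI[of _ "fst \<circ> z"], rule exI[of _ "snd \<circ> z"], intro conjI allI ballI impI)
    show "\<not> p dvd B" by (rule B)
    fix K
    obtain \<alpha> \<gamma> where zz: "z (Suc K) = (fst (z K) + p ^ K * \<alpha>, snd (z K) + p ^ K * \<gamma>)"
      and v: "\<And>n m. n \<in> {0..<N} \<Longrightarrow> \<not> p dvd m - \<alpha> * n - \<gamma> \<Longrightarrow> [G K (z K) n m = B * (m - \<alpha> * n - \<gamma>)] (mod p)"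
      using z[of K] unfolding Q_def by blast
    show "p ^ K dvd (fst \<circ> z) (Suc K) - (fst \<circ> z) K" "p ^ K dvd (snd \<circ> z) (Suc K) - (snd \<circ> z) K"
      by (simp_all add: zz)
    fix n m y
    assume n: "n \<in> {0..<N}" and m: "m - (fst \<circ> z) (Suc K) * n - (snd \<circ> z) (Suc K) = p ^ K * y" and y: "\<not> p dvd y"
    \<comment> \<open>The cell belongs to the board of stage \<open>K\<close>, at height
      \<open>\<alpha> * n + \<gamma> + y\<close>, where the form of that stage equals
      \<open>B * y\<close>.\<close>
    have "p ^ K * (\<alpha> * n + \<gamma> + y) + fst (z K) * n + snd (z K) = m"
      using m by (simp add: zz algebra_simps)
    then show "[F n m = B * y] (mod p)"
      using v[OF n, of "\<alpha> * n + \<gamma> + y"] y by (simp add: G_def)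
  qed
qed

end

section \<open>p-adic coordinates\<close>

lemma padic_val_unit_iff:
  assumes "p > 1" "x \<in> carrier (padic_ints p)"
  shows "padic_val p x = 0 \<longleftrightarrow> x 1 \<noteq> 0"
proof -
  have "x 0 = 0"
    using padic_coord_mod(1)[OF assms(2), of 0] by simp
  then show ?thesis
    using padic_val_eq_enat_iff[OF assms, of 0] by (simp add: zero_enat_def)
qed

lemma last_nonzero_digit_eq:
  assumes p: "p > 1" and x: "x \<in> carrier (padic_ints p)" "x k = 0" "x (Suc k) \<noteq> 0"
  shows "last_nonzero_digit p x = x (Suc k) div int p ^ k"
proof -
  have nz: "x \<noteq> \<zero>\<^bsub>padic_ints p\<^esub>"
    using x(3) by (auto simp: padic_ints_simps)
  have val: "padic_val p x = enat k"
    using padic_val_eq_enat_iff[OF p x(1)] x by simp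
  have "padic_unit_part p x \<in> carrier (padic_ints p) \<and>
      x = padic_of_int p (int p ^ k) \<otimes>\<^bsub>padic_ints p\<^esub> padic_unit_part p x"
    using theI'[OF padic_unit_part_unique[OF p x(1) nz]] val unfolding padic_unit_part_def by simp
  then have "x (k + 1) = int p ^ k * padic_unit_part p x 1"
    using padic_quotient_coord by blast
  then show ?thesis
    using nz p by (simp add: last_nonzero_digit_def padic_reduce_def)
qed

lemma last_nonzero_digit_of_unit:
  assumes "p > 1" "x \<in> carrier (padic_ints p)" "x 1 \<noteq> 0"
  shows "last_nonzero_digit p x = x 1"
proof -
  have "x 0 = 0"
    using padic_coord_mod(1)[OF assms(2), of 0] by simp
  then show ?thesis
    using last_nonzero_digit_eq[OF assms(1,2), of 0] assms(3) by simp
qed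

lemma last_nonzero_digit_of_int:
  assumes "p > 1" "int p ^ k dvd z" "\<not> int p ^ Suc k dvd z"
  shows "last_nonzero_digit p (padic_of_int p z) = z div int p ^ k mod int p"
proof -
  have "last_nonzero_digit p (padic_of_int p z) = z mod int p ^ Suc k div int p ^ k"
    using assms padic_of_int_closed[of p z]
    by (subst last_nonzero_digit_eq[of _ _ k]) (auto simp: padic_of_int_def dvd_eq_mod_eq_0)
  also have "\<dots> = z div int p ^ k mod int p"
  proof -
    obtain y where y: "z = int p ^ k * y"
      using assms(2) ..
    have "z mod int p ^ Suc k = int p ^ k * (y mod int p)"
      unfolding y by (simp add: mult.commute[of "int p"] flip: mult_mod_right)
    then show ?thesis
      using assms(1) y by simp
  qed
  finally show ?thesis .
qed

lemma padic_val_of_int_le_1_iff: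
  assumes "p > 1"
  shows "padic_val p (padic_of_int p z) \<le> 1 \<longleftrightarrow> \<not> int p ^ 2 dvd z"
proof -
  have val: "padic_val p (padic_of_int p z) = enat k \<longleftrightarrow> int p ^ k dvd z \<and> \<not> int p ^ Suc k dvd z" for k
    using padic_val_eq_enat_iff[OF assms padic_of_int_closed[of p z]] assms
    by (simp add: padic_of_int_def dvd_eq_mod_eq_0)
  show ?thesis
  proof
    assume "padic_val p (padic_of_int p z) \<le> 1"
    then obtain k where "padic_val p (padic_of_int p z) = enat k" "k \<le> 1"
      by (metis enat_ile enat_ord_simps(1) one_enat_def)
    then have "\<not> int p ^ Suc k dvd z" "int p ^ Suc k dvd int p ^ 2"
      using val le_imp_power_dvd[of "Suc k" 2 "int p"] by auto
    then show "\<not> int p ^ 2 dvd z"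
      using dvd_trans by blast
  next
    assume n: "\<not> int p ^ 2 dvd z"
    show "padic_val p (padic_of_int p z) \<le> 1"
    proof (cases "int p dvd z")
      case True
      then show ?thesis
        using val[of 1] n by (simp add: power2_eq_square one_enat_def)
    next
      case False
      then show ?thesis
        using val[of 0] by (simp flip: zero_enat_def)
    qed
  qed
qed

lemma nonzero_residues_eq: "nonzero_residues p = {0<..<int p}"
  by (auto simp: nonzero_residues_def residue_ring_def)

lemma mem_sudoku_rule_iff:
  assumes "p > 1"
  shows "g \<in> sudoku_rule p N \<longleftrightarrow> g \<in> {0..<int N} \<rightarrow> {0<..<int p} \<and>
    (\<exists>a b. \<not> (int p dvd a \<and> int p dvd b) \<and> (\<forall>n\<in>{0..<int N}. \<forall>k\<in>{0, 1}.
      int p ^ k dvd a * n + b \<longrightarrow> \<not> int p ^ Suc k dvd a * n + b \<longrightarrow> g n = (a * n + b) div int p ^ k mod int p))"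
proof -
  have "(padic_val p (padic_of_int p z) \<le> 1 \<longrightarrow> y = last_nonzero_digit p (padic_of_int p z)) \<longleftrightarrow>
     (\<forall>k\<in>{0, 1}. int p ^ k dvd z \<longrightarrow> \<not> int p ^ Suc k dvd z \<longrightarrow> y = z div int p ^ k mod int p)" for y z
  proof (cases "int p ^ 2 dvd z")
    case True
    then have "int p dvd z"
      by (metis dvd_trans dvd_triv_left power2_eq_square)
    then show ?thesis
      using True padic_val_of_int_le_1_iff[OF assms, of z] by (simp add: power2_eq_square)
  next
    case False
    then show ?thesis
      using padic_val_of_int_le_1_iff[OF assms, of z] last_nonzero_digit_of_int[OF assms, of 0 z]
        last_nonzero_digit_of_int[OF assms, of 1 z]
      by (cases "int p dvd z") (auto simp: power2_eq_square)
  qed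
  then show ?thesis
    unfolding sudoku_rule_def nonzero_residues_eq by auto
qed

section \<open>Solutions from p-adic affine forms\<close>

lemma padic_affine_coord:
  "padic_affine p A B C n m k = (A k * n + B k * m + C k) mod int p ^ k"
  by (simp add: padic_affine_def padic_ints_simps padic_of_int_def mod_simps)

lemma padic_affine_closed:
  assumes "p > 0" "A \<in> carrier (padic_ints p)" "B \<in> carrier (padic_ints p)" "C \<in> carrier (padic_ints p)"
  shows "padic_affine p A B C n m \<in> carrier (padic_ints p)"
  unfolding padic_affine_def using assms by (intro padic_closed padic_of_int_closed)

text \<open>
  Along a line the affine form is \<open>D n + E\<close> with p-adic \<open>D\<close> and \<open>E\<close>. Dividing by the largest common
  power \<open>p ^ K\<close> and truncating modulo \<open>p ^ (K + 2)\<close> yields the integers required by the rule.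
\<close>

lemma padic_line_mem_sudoku_rule:
  assumes p: "p > 1"
    and D: "\<And>k. [D (Suc k) = D k] (mod int p ^ k)" and E: "\<And>k. [E (Suc k) = E k] (mod int p ^ k)"
    and x: "\<And>n. x n \<in> carrier (padic_ints p)" "\<And>n k. x n k = (D k * n + E k) mod int p ^ k"
    and g: "\<And>n. n \<in> {0..<int N} \<Longrightarrow> g n = last_nonzero_digit p (x n)"
  shows "g \<in> sudoku_rule p N"
proof -
  let ?p = "int p"
  let ?dvd = "\<lambda>k. ?p ^ k dvd D k \<and> ?p ^ k dvd E k"
  have p0: "?p ^ k \<noteq> 0" for k
    using p by simp
  have range: "g \<in> {0..<int N} \<rightarrow> {0<..<?p}"
    using g last_nonzero_digit_in_nonzero_residues[OF p x(1)] by (simp add: nonzero_residues_eq)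
  have "\<exists>a b. \<not> (?p dvd a \<and> ?p dvd b) \<and> (\<forall>n\<in>{0..<int N}. \<forall>k\<in>{0, 1}.
      ?p ^ k dvd a * n + b \<longrightarrow> \<not> ?p ^ Suc k dvd a * n + b \<longrightarrow> g n = (a * n + b) div ?p ^ k mod ?p)"
  proof (cases "\<forall>k. ?dvd k")
    case True
    have "x n = \<zero>\<^bsub>padic_ints p\<^esub>" for n
      using True by (auto simp: padic_ints_simps x(2))
    \<comment> \<open>On a line of zeros the default digit 1 applies, and the constant function 1
      obeys the rule with \<open>a = 0\<close>, \<open>b = 1\<close>.\<close>
    then have "g n = 1" if "n \<in> {0..<int N}" for n
      using g[OF that] by (simp add: last_nonzero_digit_def residue_ring_def)
    then show ?thesis
      using p by (intro exI[of _ 0] exI[of _ 1]) auto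
  next
    case False
    define L where "L = (LEAST k. \<not> ?dvd k)"
    have L: "\<not> ?dvd L"
      using False unfolding L_def by (metis (mono_tags, lifting) LeastI)
    then obtain K where K: "L = Suc K"
      by (cases L) auto
    have dK: "?dvd K"
      using not_less_Least[of K "\<lambda>k. \<not> ?dvd k"] K unfolding L_def by simp
    have D1: "[D (Suc K) = D K] (mod ?p ^ K)" and E1: "[E (Suc K) = E K] (mod ?p ^ K)"
      by (rule D E)+
    have D2: "[D (Suc (Suc K)) = D (Suc K)] (mod ?p ^ Suc K)" and E2: "[E (Suc (Suc K)) = E (Suc K)] (mod ?p ^ Suc K)"
      by (rule D E)+
    have "?p ^ K dvd D (Suc (Suc K))" "?p ^ K dvd E (Suc (Suc K))"
      using dK D1 E1 cong_dvd_modulus[OF D2, of "?p ^ K"] cong_dvd_modulus[OF E2, of "?p ^ K"]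
      by (simp_all add: cong_dvd_iff)
    then obtain a b where ab: "D (Suc (Suc K)) = ?p ^ K * a" "E (Suc (Suc K)) = ?p ^ K * b"
      unfolding dvd_def by blast
    have nab: "\<not> (?p dvd a \<and> ?p dvd b)"
    proof
      assume "?p dvd a \<and> ?p dvd b"
      then have "?p ^ Suc K dvd D (Suc (Suc K))" "?p ^ Suc K dvd E (Suc (Suc K))"
        by (auto simp: ab mult.commute)
      then show False
        using L D2 E2 by (simp add: K cong_dvd_iff)
    qed
    have "g n = (a * n + b) div ?p ^ k mod ?p"
      if n: "n \<in> {0..<int N}" and k: "k \<in> {0, 1}" and dvd: "?p ^ k dvd a * n + b" "\<not> ?p ^ Suc k dvd a * n + b" for n k
    proof -
      define z where "z = ?p ^ K * (a * n + b)"
      have coord: "x n i = padic_of_int p z i" if "i \<le> Suc (Suc K)" for i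
      proof -
        have "x n (Suc (Suc K) - i + i) mod ?p ^ i = x n i"
          by (rule padic_coord_mod(2)[OF x(1)])
        then have "x n i = z mod ?p ^ Suc (Suc K) mod ?p ^ i"
          using that by (simp add: x(2)[of n "Suc (Suc K)"] ab z_def algebra_simps)
        also have "\<dots> = z mod ?p ^ i"
          using that by (intro mod_mod_cancel le_imp_power_dvd)
        finally show ?thesis
          by (simp add: padic_of_int_def)
      qed
      have zd: "?p ^ (K + k) dvd z" "\<not> ?p ^ Suc (K + k) dvd z"
        using dvd p by (auto simp: z_def power_add mult.left_commute)
      have "x n (K + k) = 0" "x n (Suc (K + k)) \<noteq> 0"
        using zd k by (auto simp: coord padic_of_int_def dvd_eq_mod_eq_0)
      then have "g n = x n (Suc (K + k)) div ?p ^ (K + k)"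
        using g[OF n] last_nonzero_digit_eq[OF p x(1)] by simp
      also have "\<dots> = padic_of_int p z (Suc (K + k)) div ?p ^ (K + k)"
        using k by (subst coord) auto
      also have "\<dots> = last_nonzero_digit p (padic_of_int p z)"
        using zd p padic_of_int_closed[of p z]
        by (subst last_nonzero_digit_eq[of _ _ "K + k"]) (auto simp: padic_of_int_def dvd_eq_mod_eq_0)
      also have "\<dots> = z div ?p ^ (K + k) mod ?p"
        by (rule last_nonzero_digit_of_int[OF p zd])
      also have "z div ?p ^ (K + k) = (a * n + b) div ?p ^ k"
        using p by (simp add: z_def power_add)
      finally show ?thesis .
    qed
    then show ?thesis
      using nab by blast
  qed
  then show ?thesis
    using range by (simp add: mem_sudoku_rule_iff[OF p])
qed

lemma padic_cong_Suc:
  "x \<in> carrier (padic_ints p) \<Longrightarrow> [x (Suc k) = x k] (mod int p ^ k)"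
  using padic_coord_mod(1)[of x p k] by (simp add: padic_ints_simps cong_def)

lemma padic_affine_sudoku_solution:
  assumes p: "p > 1"
    and ABC: "A \<in> carrier (padic_ints p)" "B \<in> carrier (padic_ints p)" "C \<in> carrier (padic_ints p)"
    and F: "\<And>n m. n \<in> {0..<int N} \<Longrightarrow> F (n, m) = last_nonzero_digit p (padic_affine p A B C n m)"
  shows "sudoku_solution p N F"
  unfolding sudoku_solution_def
proof (intro conjI allI)
  have closed: "padic_affine p A B C n m \<in> carrier (padic_ints p)" for n m
    using p ABC by (intro padic_affine_closed) auto
  show "F \<in> board N \<rightarrow> nonzero_residues p"
    using F last_nonzero_digit_in_nonzero_residues[OF p closed] by (auto simp: board_def)
  fix j i
  show "(\<lambda>n. F (n, j * n + i)) \<in> sudoku_rule p N"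
  proof (rule padic_line_mem_sudoku_rule[OF p])
    show "[A (Suc k) + B (Suc k) * j = A k + B k * j] (mod int p ^ k)"
      "[B (Suc k) * i + C (Suc k) = B k * i + C k] (mod int p ^ k)" for k
      using ABC by (intro cong_add cong_mult padic_cong_Suc cong_refl; simp)+
    show "padic_affine p A B C n (j * n + i) k = ((A k + B k * j) * n + (B k * i + C k)) mod int p ^ k" for n k
      by (simp add: padic_affine_coord algebra_simps)
  qed (use F closed in auto)
qed

text \<open>As \<open>B\<close> is a unit, \<open>m\<close> can be chosen to give the affine value
  the residue 1 or 2. These are their own last nonzero digits and differ because
  \<open>p > 2\<close>.\<close>

lemma padic_affine_nonconstant_columns:
  assumes p: "prime p" "p > 2"
    and ABC: "A \<in> carrier (padic_ints p)" "B \<in> carrier (padic_ints p)" "C \<in> carrier (padic_ints p)"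
    and F: "\<And>n m. n \<in> {0..<int N} \<Longrightarrow> F (n, m) = last_nonzero_digit p (padic_affine p A B C n m)"
    and B: "padic_val p B = 0"
  shows "nonconstant_columns N F"
  unfolding nonconstant_columns_def
proof (intro ballI notI)
  fix n assume n: "n \<in> {0..<int N}" and "\<exists>c. \<forall>m. F (n, m) = c"
  then obtain c where c: "\<And>m. F (n, m) = c" by blast
  have closed: "padic_affine p A B C n m \<in> carrier (padic_ints p)" for n m
    using p ABC by (intro padic_affine_closed) auto
  have "B 1 \<noteq> 0"
    using padic_val_unit_iff[OF _ ABC(2)] B p by simp
  moreover have "B 1 \<in> {0..<int p ^ 1}"
    using ABC(2) unfolding padic_ints_simps by blast
  ultimately have B1: "\<not> int p dvd B 1"
    using zdvd_imp_le[of "int p" "B 1"] by auto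
  have "c = v" if v: "v \<in> {1, 2}" for v
  proof -
    have "prime (int p)"
      using p(1) by simp
    then obtain m where "int p dvd (A 1 * n + C 1 - v) + B 1 * m"
      using exists_affine_root[OF _ B1] by blast
    then have "[A 1 * n + B 1 * m + C 1 = v] (mod int p)"
      by (simp add: cong_iff_dvd_diff algebra_simps)
    then have "padic_affine p A B C n m 1 = v"
      using v p by (simp add: padic_affine_coord cong_def) auto
    then show ?thesis
      using last_nonzero_digit_of_unit[OF _ closed, of n m] F[OF n, of m] c v p by auto
  qed
  from this[of 1] this[of 2] show False by simp
qed

section \<open>p-adic affine forms from solutions\<close>

lemma sudoku_solution_imp_sudoku_array:
  assumes p: "prime p" "p \<ge> 53" and N: "p\<^sup>2 dvd N" "N > 0"
    and F: "sudoku_solution p N F" "nonconstant_columns N F"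
  shows "sudoku_array (int p) (int N) (\<lambda>n m. F (n, m))"
proof
  have "p > 1"
    using p by simp
  show "prime (int p)" "53 \<le> int p"
    using p by auto
  have "p\<^sup>2 \<le> N"
    using N by (rule dvd_imp_le)
  then show "int p ^ 2 \<le> int N"
    by (metis of_nat_le_iff of_nat_power)
  fix n m j i
  show "F (n, m) \<in> {0<..<int p}" if "n \<in> {0..<int N}"
    using F(1) that by (auto simp: sudoku_solution_def board_def nonzero_residues_eq)
  show "\<exists>m m'. F (n, m) \<noteq> F (n, m')" if "n \<in> {0..<int N}"
    using F(2) that unfolding nonconstant_columns_def by metis
  obtain a b where ab: "\<not> (int p dvd a \<and> int p dvd b)" and
    v: "\<And>n k. n \<in> {0..<int N} \<Longrightarrow> k \<in> {0, 1} \<Longrightarrow> int p ^ k dvd a * n + b \<Longrightarrow> \<not> int p ^ Suc k dvd a * n + b \<Longrightarrow>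
      F (n, j * n + i) = (a * n + b) div int p ^ k mod int p"
    using F(1) unfolding sudoku_solution_def mem_sudoku_rule_iff[OF \<open>p > 1\<close>] by blast
  show "\<exists>a b. \<not> (int p dvd a \<and> int p dvd b) \<and> (\<forall>n\<in>{0..<int N}.
      (\<not> int p dvd a * n + b \<longrightarrow> [F (n, j * n + i) = a * n + b] (mod int p)) \<and>
      (int p dvd a * n + b \<and> \<not> int p ^ 2 dvd a * n + b \<longrightarrow> [F (n, j * n + i) = (a * n + b) div int p] (mod int p)))"
    using ab v[of _ 0] v[of _ 1] by (intro exI[of _ a] exI[of _ b]) (simp add: cong_def power2_eq_square)
qed

lemma sudoku_solution_imp_padic_affine:
  assumes p: "prime p" "p \<ge> 53" and N: "p\<^sup>2 dvd N" "N > 0"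
    and F: "sudoku_solution p N F" "nonconstant_columns N F"
  shows "\<exists>A\<in>carrier (padic_ints p). \<exists>B\<in>carrier (padic_ints p). \<exists>C\<in>carrier (padic_ints p).
    padic_val p B = 0 \<and> (\<forall>n\<in>{0..<int N}. \<forall>m. padic_affine p A B C n m \<noteq> \<zero>\<^bsub>padic_ints p\<^esub> \<longrightarrow>
      F (n, m) = last_nonzero_digit p (padic_affine p A B C n m))"
proof -
  interpret sudoku_array "int p" "int N" "\<lambda>n m. F (n, m)"
    by (rule sudoku_solution_imp_sudoku_array[OF assms])
  have p1: "p > 1"
    using p by simp
  obtain B a c where B: "\<not> int p dvd B"
    and ac: "\<And>K. int p ^ K dvd a (Suc K) - a K" "\<And>K. int p ^ K dvd c (Suc K) - c K"
    and v: "\<And>K n m y. n \<in> {0..<int N} \<Longrightarrow> m - a (Suc K) * n - c (Suc K) = int p ^ K * y \<Longrightarrow> \<not> int p dvd y \<Longrightarrow>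
      [F (n, m) = B * y] (mod int p)"
    using exists_padic_lines by blast
  have closed: "(\<lambda>k. - B * e k mod int p ^ k) \<in> carrier (padic_ints p)"
    if "\<And>K. int p ^ K dvd e (Suc K) - e K" for e
  proof -
    have "- B * e (Suc k) mod int p ^ Suc k mod int p ^ k = - B * e k mod int p ^ k" for k
    proof -
      have "[- B * e (Suc k) = - B * e k] (mod int p ^ k)"
        using that by (intro cong_scalar_left) (simp add: cong_iff_dvd_diff)
      then show ?thesis
        by (simp add: mod_mod_cancel cong_def)
    qed
    then show ?thesis
      using p1 by (simp add: padic_ints_simps)
  qed
  let ?A = "\<lambda>k. - B * a k mod int p ^ k" and ?B = "padic_of_int p B" and ?C = "\<lambda>k. - B * c k mod int p ^ k"
  have mem: "?A \<in> carrier (padic_ints p)" "?B \<in> carrier (padic_ints p)" "?C \<in> carrier (padic_ints p)"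
    using ac p1 by (intro closed padic_of_int_closed; simp)+
  have coord: "padic_affine p ?A ?B ?C n m k = B * (m - a k * n - c k) mod int p ^ k" for n m k
  proof -
    have "[X mod q * n + Y mod q * m + Z mod q = X * n + Y * m + Z] (mod q)" for X Y Z q :: int
      by (intro cong_add cong_mult) simp_all
    note this[unfolded cong_def]
    then show ?thesis
      unfolding padic_affine_coord padic_of_int_def by (simp only:) (simp add: algebra_simps)
  qed
  have "padic_val p ?B = 0"
    using padic_val_unit_iff[OF p1 mem(2)] B by (simp add: padic_of_int_def dvd_eq_mod_eq_0)
  moreover have "F (n, m) = last_nonzero_digit p (padic_affine p ?A ?B ?C n m)"
    if n: "n \<in> {0..<int N}" and nz: "padic_affine p ?A ?B ?C n m \<noteq> \<zero>\<^bsub>padic_ints p\<^esub>" for n m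
  proof -
    define x where "x = padic_affine p ?A ?B ?C n m"
    have x: "x \<in> carrier (padic_ints p)"
      unfolding x_def using p1 mem by (intro padic_affine_closed) auto
    obtain K where K: "padic_val p x = enat K"
      using nz by (auto simp: padic_val_def x_def)
    then have xK: "x K = 0" "x (Suc K) \<noteq> 0"
      using padic_val_eq_enat_iff[OF p1 x] by auto
    \<comment> \<open>\<open>exists_padic_lines\<close> speaks of the shifts with index
      \<open>Suc K\<close>. Cancelling the unit \<open>B\<close> gives divisibility for index
      \<open>K\<close>, and the change of index costs only a multiple of
      \<open>p ^ K\<close>.\<close>
    have "int p ^ K dvd B * (m - a K * n - c K)"
      using xK(1) unfolding x_def coord by (rule mod_0_imp_dvd)
    moreover have "coprime (int p ^ K) B"
      using B p(1) by (intro coprime_power_left_iff[THEN iffD2] disjI1) (simp add: prime_imp_coprime)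
    ultimately have "int p ^ K dvd m - a K * n - c K"
      using coprime_dvd_mult_right_iff by blast
    moreover have "int p ^ K dvd (a (Suc K) - a K) * n + (c (Suc K) - c K)"
      using ac by simp
    ultimately have "int p ^ K dvd (m - a K * n - c K) - ((a (Suc K) - a K) * n + (c (Suc K) - c K))"
      by (rule dvd_diff)
    also have "\<dots> = m - a (Suc K) * n - c (Suc K)"
      by (simp add: algebra_simps)
    finally obtain y where y: "m - a (Suc K) * n - c (Suc K) = int p ^ K * y" ..
    have "x (Suc K) = int p ^ K * (B * y) mod (int p ^ K * int p)"
      unfolding x_def coord y by (simp add: algebra_simps)
    then have xS: "x (Suc K) = int p ^ K * (B * y mod int p)"
      by (simp only: mult_mod_right)
    then have "\<not> int p dvd y"
      using xK(2) by auto
    then have "[F (n, m) = B * y] (mod int p)"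
      using v[OF n y] by simp
    moreover have "F (n, m) \<in> {0<..<int p}"
      by (rule range[OF n])
    ultimately have "F (n, m) = B * y mod int p"
      by (simp add: cong_def)
    also have "\<dots> = x (Suc K) div int p ^ K"
      using xS p1 by simp
    also have "\<dots> = last_nonzero_digit p x"
      using last_nonzero_digit_eq[OF p1 x xK] by simp
    finally show ?thesis
      by (simp add: x_def)
  qed
  ultimately show ?thesis
    using mem by blast
qed

theorem theorem4p6:
  fixes p N :: nat
  assumes "prime p" and "p > 48" and "p\<^sup>2 dvd N"
  shows
    "(\<forall>A\<in>carrier (padic_ints p). \<forall>B\<in>carrier (padic_ints p). \<forall>C\<in>carrier (padic_ints p).
        \<forall>F\<in>board N \<rightarrow> nonzero_residues p.
          \<not> (A = \<zero>\<^bsub>padic_ints p\<^esub> \<and> B = \<zero>\<^bsub>padic_ints p\<^esub> \<and> C = \<zero>\<^bsub>padic_ints p\<^esub>) \<longrightarrow>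
          (\<forall>(n, m)\<in>board N. F (n, m) = last_nonzero_digit p (padic_affine p A B C n m)) \<longrightarrow>
          sudoku_solution p N F \<and>
          (padic_val p B = 0 \<longrightarrow> nonconstant_columns N F)) \<and>
     (\<forall>F. sudoku_solution p N F \<and> nonconstant_columns N F \<longrightarrow>
        (\<exists>A\<in>carrier (padic_ints p). \<exists>B\<in>carrier (padic_ints p). \<exists>C\<in>carrier (padic_ints p).
          padic_val p B = 0 \<and>
          (\<forall>(n, m)\<in>board N. padic_affine p A B C n m \<noteq> \<zero>\<^bsub>padic_ints p\<^esub> \<longrightarrow>
            F (n, m) = last_nonzero_digit p (padic_affine p A B C n m))))"
proof -
  have board: "(\<forall>(n, m)\<in>board N. P n m) \<longleftrightarrow> (\<forall>n\<in>{0..<int N}. \<forall>m. P n m)" for P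
    by (auto simp: board_def)
  have p1: "p > 1" "p > 2"
    using assms(2) by auto
  \<comment> \<open>The first prime above 48 is 53, the bound used in the averaging.\<close>
  have "\<not> prime p" if "p \<in> {49, 50, 51, 52}"
  proof -
    have "7 dvd p \<or> 2 dvd p \<or> 3 dvd p"
      using that by auto
    then show ?thesis
      using that by (auto simp: prime_nat_iff)
  qed
  then have p53: "p \<ge> 53"
    using assms(1,2) by fastforce
  have conv: "\<exists>A\<in>carrier (padic_ints p). \<exists>B\<in>carrier (padic_ints p). \<exists>C\<in>carrier (padic_ints p).
      padic_val p B = 0 \<and> (\<forall>n\<in>{0..<int N}. \<forall>m. padic_affine p A B C n m \<noteq> \<zero>\<^bsub>padic_ints p\<^esub> \<longrightarrow>
        F (n, m) = last_nonzero_digit p (padic_affine p A B C n m))"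
    if "sudoku_solution p N F" "nonconstant_columns N F" for F
  \<comment> \<open>Zero is a multiple of \<open>p ^ 2\<close>. The board is then empty, and any
    coefficients with \<open>B\<close> a unit serve.\<close>
  proof (cases "N = 0")
    case True
    have "padic_val p (padic_of_int p 1) = 0"
      using padic_val_unit_iff[OF p1(1) padic_of_int_closed[of p 1]] p1 by (simp add: padic_of_int_def)
    then show ?thesis
      using True padic_of_int_closed[of p 1] p1 by auto
  next
    case False
    then show ?thesis
      using sudoku_solution_imp_padic_affine[OF assms(1) p53 assms(3) _ that] by simp
  qed
  show ?thesis
    unfolding board
  proof (intro conjI ballI impI allI, goal_cases)
    case (1 A B C F)
    then show ?case
      by (intro padic_affine_sudoku_solution[OF p1(1), of A B C]) auto
  next
    case (2 A B C F)
    then show ?case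
      by (intro padic_affine_nonconstant_columns[OF assms(1) p1(2), of A B C]) auto
  next
    case (3 F)
    then show ?case
      by (intro conv) auto
  qed
qed

end
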